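(* Let $(\Omega,\mathcal F,\mathbb P)$ be a complete measure space. The correspondence $v\mapsto H_v$, where for a real Hilbert space $\mathcal H$ and $v\in L^2(\Omega,\mathcal H)$ the operator $H_v:\mathcal H\to L^2(\Omega)$ is given by $(H_vx)(\omega)=\langle v(\omega),x\rangle_{\mathcal H}$, is a natural isomorphism between the functors $L^2(\Omega,-)$ and $\mathrm{HS}(-,L^2(\Omega))$ on the category $\mathbf{Hilbert}$. That is, for each $\mathcal H$ the map $v\mapsto H_v$ is an isomorphism of Hilbert spaces $L^2(\Omega,\mathcal H)\to\mathrm{HS}(\mathcal H,L^2(\Omega))$, and for all real Hilbert spaces $\mathcal H,\mathcal K$, every bounded linear $T:\mathcal H\to\mathcal K$ and every $v\in L^2(\Omega,\mathcal H)$, one has $H_{Tv}=H_v\circ T^*$.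
   Context: $\mathbf{Hilbert}$ is the category of real Hilbert spaces with norm-continuous linear operators as morphisms. $L^2(\Omega,\mathcal H)$ is the Hilbert space of ($\mathbb P$-a.e. equivalence classes of) Bochner measurable functions $v:\Omega\to\mathcal H$ (i.e. $\mathbb P$-a.e. norm limits of sequences of simple functions, a simple function being one equal $\mathbb P$-a.e. to a finite sum $\sum_n\mathbb I_{E_n}e_n$ with $E_n\in\mathcal F$, $e_n\in\mathcal H$) with $\int_\Omega\|v(\omega)\|_{\mathcal H}^2\,d\mathbb P<\infty$, with inner product $\int_\Omega\langle u(\omega),v(\omega)\rangle_{\mathcal H}\,d\mathbb P$. $L^2(\Omega)$ is the space of (classes of) real-valued square-integrable $\mathcal F$-measurable functions. $\mathrm{HS}(\mathcal H,\mathcal G)$ is the Hilbert space of Hilbert-Schmidt operators: bounded linear $H:\mathcal H\to\mathcal G$ with $\sum_{e\in\mathscr E}\|He\|_{\mathcal G}^2<\infty$ for an arbitrary orthonormal basis $\mathscr E$ of $\mathcal H$, with norm $\left(\sum_{e\in\mathscr E}\|He\|_{\mathcal G}^2\right)^{1/2}$ (independent of $\mathscr E$). The functor $L^2(\Omega,-)$ sends $\mathcal H$ to $L^2(\Omega,\mathcal H)$ and a bounded operator $T:\mathcal H\to\mathcal K$ to the operator $L^2(\Omega,\mathcal H)\to L^2(\Omega,\mathcal K)$, $v\mapsto Tv$, where $(Tv)(\omega)=T(v(\omega))$. The functor $\mathrm{HS}(-,L^2(\Omega))$ sends $\mathcal H$ to $\mathrm{HS}(\mathcal H,L^2(\Omega))$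 and $T:\mathcal H\to\mathcal K$ to the operator $(-\circ T^* ):\mathrm{HS}(\mathcal H,L^2(\Omega))\to\mathrm{HS}(\mathcal K,L^2(\Omega))$, $H\mapsto HT^*$, where $T^*:\mathcal K\to\mathcal H$ is the Hilbert space adjoint. *)

theory Defs
  imports "HOL-Analysis.Analysis"
begin

section \<open>Real Hilbert spaces with explicit carrier\<close>

text \<open>
  The arguments of the two functors are types of sort \<open>{real_inner, banach}\<close>.  Their values depend
  on a measure, hence are not types; they are represented by records with an explicit carrier.
  The operations are constrained on the carrier only.
\<close>

record 'v hspace =
  hcarrier :: "'v set"
  hadd :: "'v \<Rightarrow> 'v \<Rightarrow> 'v"
  hscale :: "real \<Rightarrow> 'v \<Rightarrow> 'v"
  hzero :: "'v"
  hip :: "'v \<Rightarrow> 'v \<Rightarrow> real"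

definition hnorm :: "'v hspace \<Rightarrow> 'v \<Rightarrow> real" where
  "hnorm V x = sqrt (hip V x x)"

definition hdist :: "'v hspace \<Rightarrow> 'v \<Rightarrow> 'v \<Rightarrow> real" where
  "hdist V x y = hnorm V (hadd V x (hscale V (- 1) y))"

locale hilbert_space =
  fixes V :: "'v hspace"
  assumes add_closed: "\<lbrakk>x \<in> hcarrier V; y \<in> hcarrier V\<rbrakk> \<Longrightarrow> hadd V x y \<in> hcarrier V"
    and scale_closed: "x \<in> hcarrier V \<Longrightarrow> hscale V a x \<in> hcarrier V"
    and zero_closed: "hzero V \<in> hcarrier V"
    and add_assoc: "\<lbrakk>x \<in> hcarrier V; y \<in> hcarrier V; z \<in> hcarrier V\<rbrakk>
      \<Longrightarrow> hadd V (hadd V x y) z = hadd V x (hadd V y z)"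
    and add_commute: "\<lbrakk>x \<in> hcarrier V; y \<in> hcarrier V\<rbrakk> \<Longrightarrow> hadd V x y = hadd V y x"
    and add_zero: "x \<in> hcarrier V \<Longrightarrow> hadd V x (hzero V) = x"
    and add_neg: "x \<in> hcarrier V \<Longrightarrow> hadd V x (hscale V (- 1) x) = hzero V"
    and scale_add_right: "\<lbrakk>x \<in> hcarrier V; y \<in> hcarrier V\<rbrakk>
      \<Longrightarrow> hscale V a (hadd V x y) = hadd V (hscale V a x) (hscale V a y)"
    and scale_add_left: "x \<in> hcarrier V \<Longrightarrow> hscale V (a + b) x = hadd V (hscale V a x) (hscale V b x)"
    and scale_scale: "x \<in> hcarrier V \<Longrightarrow> hscale V a (hscale V b x) = hscale V (a * b) x"
    and scale_one: "x \<in> hcarrier V \<Longrightarrow> hscale V 1 x = x"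
    and ip_commute: "\<lbrakk>x \<in> hcarrier V; y \<in> hcarrier V\<rbrakk> \<Longrightarrow> hip V x y = hip V y x"
    and ip_add_left: "\<lbrakk>x \<in> hcarrier V; y \<in> hcarrier V; z \<in> hcarrier V\<rbrakk>
      \<Longrightarrow> hip V (hadd V x y) z = hip V x z + hip V y z"
    and ip_scale_left: "\<lbrakk>x \<in> hcarrier V; y \<in> hcarrier V\<rbrakk>
      \<Longrightarrow> hip V (hscale V a x) y = a * hip V x y"
    and ip_nonneg: "x \<in> hcarrier V \<Longrightarrow> 0 \<le> hip V x x"
    and ip_definite: "\<lbrakk>x \<in> hcarrier V; hip V x x = 0\<rbrakk> \<Longrightarrow> x = hzero V"
    and complete: "\<lbrakk>range s \<subseteq> hcarrier V;
        \<And>\<epsilon>. 0 < \<epsilon> \<Longrightarrow> \<exists>N. \<forall>m\<ge>N. \<forall>n\<ge>N. hdist V (s m) (s n) < \<epsilon>\<rbrakk>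
      \<Longrightarrow> \<exists>x\<in>hcarrier V. (\<lambda>n. hdist V (s n) x) \<longlonglongrightarrow> 0"

definition type_hspace :: "'h::{real_inner,banach} hspace" where
  "type_hspace = \<lparr>hcarrier = UNIV, hadd = (+), hscale = (*\<^sub>R), hzero = 0, hip = (\<bullet>)\<rparr>"

definition hlinear :: "'v hspace \<Rightarrow> 'w hspace \<Rightarrow> ('v \<Rightarrow> 'w) \<Rightarrow> bool" where
  "hlinear V W f \<longleftrightarrow>
     (\<forall>x\<in>hcarrier V. f x \<in> hcarrier W) \<and>
     (\<forall>x\<in>hcarrier V. \<forall>y\<in>hcarrier V. f (hadd V x y) = hadd W (f x) (f y)) \<and>
     (\<forall>a. \<forall>x\<in>hcarrier V. f (hscale V a x) = hscale W a (f x))"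

definition hbounded_linear :: "'v hspace \<Rightarrow> 'w hspace \<Rightarrow> ('v \<Rightarrow> 'w) \<Rightarrow> bool" where
  "hbounded_linear V W f \<longleftrightarrow>
     hlinear V W f \<and> (\<exists>B. \<forall>x\<in>hcarrier V. hnorm W (f x) \<le> B * hnorm V x)"

definition hilbert_isomorphism :: "'v hspace \<Rightarrow> 'w hspace \<Rightarrow> ('v \<Rightarrow> 'w) \<Rightarrow> bool" where
  "hilbert_isomorphism V W f \<longleftrightarrow>
     hilbert_space V \<and> hilbert_space W \<and> hlinear V W f \<and>
     bij_betw f (hcarrier V) (hcarrier W) \<and>
     (\<forall>x\<in>hcarrier V. \<forall>y\<in>hcarrier V. hip W (f x) (f y) = hip V x y)"


section \<open>Square-integrable functions modulo almost everywhere equality\<close>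

text \<open>
  The library's measurability notions for vector-valued functions are geared to second countable
  target spaces.  The Hilbert spaces here need not be separable, so Bochner measurability is
  defined from scratch.
\<close>

definition bochner_simple :: "'a measure \<Rightarrow> ('a \<Rightarrow> 'h::real_normed_vector) \<Rightarrow> bool" where
  "bochner_simple M v \<longleftrightarrow>
     (\<exists>(N::nat) E e. (\<forall>n<N. E n \<in> sets M) \<and>
        (AE \<omega> in M. v \<omega> = (\<Sum>n<N. indicator (E n) \<omega> *\<^sub>R e n)))"

definition bochner_measurable :: "'a measure \<Rightarrow> ('a \<Rightarrow> 'h::real_normed_vector) \<Rightarrow> bool" where
  "bochner_measurable M v \<longleftrightarrow>
     (\<exists>s. (\<forall>n. bochner_simple M (s n)) \<and> (AE \<omega> in M. (\<lambda>n. s n \<omega>) \<longlonglongrightarrow> v \<omega>))"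

definition ae_class :: "'a measure \<Rightarrow> ('a \<Rightarrow> 'h) \<Rightarrow> ('a \<Rightarrow> 'h) set" where
  "ae_class M v = {w. AE \<omega> in M. w \<omega> = v \<omega>}"

text \<open>
  The Hilbert space of classes of square-integrable functions from a given set \<open>F\<close> of measurable
  functions.  All operations are lifted from representatives; the singleton of \<open>hip\<close> expresses that
  the integral does not depend on the representatives.
\<close>

definition L2_of :: "'a measure \<Rightarrow> ('a \<Rightarrow> 'h::real_inner) set \<Rightarrow> ('a \<Rightarrow> 'h) set hspace" where
  "L2_of M F =
     \<lparr>hcarrier = ae_class M ` {v \<in> F. integrable M (\<lambda>\<omega>. (norm (v \<omega>))\<^sup>2)},
      hadd = (\<lambda>U V. \<Union>u\<in>U. \<Union>v\<in>V. ae_class M (\<lambda>\<omega>. u \<omega> + v \<omega>)),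
      hscale = (\<lambda>a V. \<Union>v\<in>V. ae_class M (\<lambda>\<omega>. a *\<^sub>R v \<omega>)),
      hzero = ae_class M (\<lambda>\<omega>. 0),
      hip = (\<lambda>U V. the_elem (\<Union>u\<in>U. \<Union>v\<in>V. {\<integral>\<omega>. u \<omega> \<bullet> v \<omega> \<partial>M}))\<rparr>"

definition L2 :: "'a measure \<Rightarrow> ('a \<Rightarrow> 'h::{real_inner,banach}) set hspace" where
  "L2 M = L2_of M {v. bochner_measurable M v}"

definition L2_real :: "'a measure \<Rightarrow> ('a \<Rightarrow> real) set hspace" where
  "L2_real M = L2_of M (borel_measurable M)"

definition L2_map :: "'a measure \<Rightarrow> ('h \<Rightarrow> 'k) \<Rightarrow> ('a \<Rightarrow> 'h) set \<Rightarrow> ('a \<Rightarrow> 'k) set" where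
  "L2_map M T V = (\<Union>v\<in>V. ae_class M (\<lambda>\<omega>. T (v \<omega>)))"


section \<open>Hilbert-Schmidt operators\<close>

definition orthonormal_basis :: "'h::real_inner set \<Rightarrow> bool" where
  "orthonormal_basis E \<longleftrightarrow>
     pairwise orthogonal E \<and> (\<forall>e\<in>E. norm e = 1) \<and> closure (span E) = UNIV"

text \<open>
  The inner product is the one that induces the Hilbert-Schmidt norm.  It is the common value of
  the defining series over all orthonormal bases; one exists by \<open>ex_orthonormal_basis\<close> below.
\<close>

definition HS :: "'w hspace \<Rightarrow> ('h::{real_inner,banach} \<Rightarrow> 'w) hspace" where
  "HS G =
     \<lparr>hcarrier = {A. hbounded_linear type_hspace G A \<and>
        (\<forall>E. orthonormal_basis E \<longrightarrow> (\<lambda>e. (hnorm G (A e))\<^sup>2) summable_on E)},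
      hadd = (\<lambda>A B x. hadd G (A x) (B x)),
      hscale = (\<lambda>a A x. hscale G a (A x)),
      hzero = (\<lambda>x. hzero G),
      hip = (\<lambda>A B. THE r. \<forall>E. orthonormal_basis E \<longrightarrow> ((\<lambda>e. hip G (A e) (B e)) has_sum r) E)\<rparr>"

definition HS_map ::
    "('h::{real_inner,banach} \<Rightarrow> 'k::{real_inner,banach}) \<Rightarrow> ('h \<Rightarrow> 'w) \<Rightarrow> ('k \<Rightarrow> 'w)" where
  "HS_map T A = A \<circ> adjoint T"

definition H_op :: "'a measure \<Rightarrow> ('a \<Rightarrow> 'h::real_inner) set \<Rightarrow> 'h \<Rightarrow> ('a \<Rightarrow> real) set" where
  "H_op M V x = (\<Union>v\<in>V. ae_class M (\<lambda>\<omega>. v \<omega> \<bullet> x))"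


section \<open>Existence of orthonormal bases and adjoints\<close>

lemma hilbert_space_type_hspace: "hilbert_space (type_hspace :: 'h::{real_inner,banach} hspace)"
proof
  fix s :: "nat \<Rightarrow> 'h"
  have d: "hdist type_hspace x y = dist x y" for x y :: 'h
    by (simp add: hdist_def hnorm_def type_hspace_def dist_norm norm_eq_sqrt_inner)
  assume "\<And>\<epsilon>. 0 < \<epsilon> \<Longrightarrow> \<exists>N. \<forall>m\<ge>N. \<forall>n\<ge>N. hdist type_hspace (s m) (s n) < \<epsilon>"
  then have "Cauchy s" by (simp add: d Cauchy_def)
  then obtain x where "s \<longlonglongrightarrow> x" using Cauchy_convergent_iff convergent_def by blast
  then show "\<exists>x\<in>hcarrier type_hspace. (\<lambda>n. hdist type_hspace (s n) x) \<longlonglongrightarrow> 0"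
    unfolding d by (intro bexI[of _ x] tendsto_dist_iff[THEN iffD1]) (auto simp: type_hspace_def)
qed (simp_all add: type_hspace_def algebra_simps, simp_all add: inner_commute)

lemma ex_orthogonal_to_closed_subspace:
  fixes S :: "'h::{real_inner,banach} set"
  assumes S: "subspace S" "closed S" and x: "x \<notin> S"
  shows "\<exists>z. z \<noteq> 0 \<and> (\<forall>s\<in>S. s \<bullet> z = 0)"
proof -
  have ne: "S \<noteq> {}" using S(1) subspace_0 by blast
  define d where "d = infdist x S"
  have d0: "0 \<le> d" by (simp add: d_def infdist_nonneg)
  have dle: "d \<le> norm (x - s)" if "s \<in> S" for s
    using infdist_le[OF that, of x] by (simp add: d_def dist_norm)
  have "\<exists>y\<in>S. (norm (x - y))\<^sup>2 < d\<^sup>2 + e" if "e > 0" for e :: real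
  proof -
    have "d < sqrt (d\<^sup>2 + e)" using d0 that by (simp add: real_less_rsqrt)
    then obtain y where y: "y \<in> S" "dist x y < sqrt (d\<^sup>2 + e)"
      unfolding d_def infdist_notempty[OF ne]
      by (subst (asm) cINF_less_iff) (auto simp: ne)
    have "(norm (x - y))\<^sup>2 < (sqrt (d\<^sup>2 + e))\<^sup>2"
      using y(2) by (intro power_strict_mono) (auto simp: dist_norm)
    then show ?thesis using y(1) that d0 by (intro bexI[of _ y]) auto
  qed
  then have "\<forall>n. \<exists>y. y \<in> S \<and> (norm (x - y))\<^sup>2 < d\<^sup>2 + 1 / real (Suc n)"
    by (metis of_nat_0_less_iff zero_less_Suc zero_less_divide_1_iff)
  then obtain y where yS: "\<And>n. y n \<in> S"
    and yd: "\<And>n. (norm (x - y n))\<^sup>2 < d\<^sup>2 + 1 / real (Suc n)"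
    by metis
  have par: "(norm (y m - y n))\<^sup>2 \<le> 2 / real (Suc m) + 2 / real (Suc n)" for m n
  proof -
    have "(1/2) *\<^sub>R (y m + y n) \<in> S"
      using S(1) yS by (intro subspace_scale subspace_add)
    then have "d\<^sup>2 \<le> (norm (x - (1/2) *\<^sub>R (y m + y n)))\<^sup>2"
      using dle d0 by (intro power_mono) auto
    moreover have "(norm (y m - y n))\<^sup>2 = 2 * (norm (x - y m))\<^sup>2 + 2 * (norm (x - y n))\<^sup>2
        - 4 * (norm (x - (1/2) *\<^sub>R (y m + y n)))\<^sup>2"
      unfolding power2_norm_eq_inner
      by (simp add: inner_diff inner_add inner_commute algebra_simps)
    ultimately show ?thesis using yd[of m] yd[of n] by simp
  qed
  have "Cauchy y"
  proof (rule metric_CauchyI)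
    fix e :: real assume e: "e > 0"
    obtain N where N: "4 / e\<^sup>2 < real N"
      using reals_Archimedean2 by blast
    then have "4 / e\<^sup>2 < real (Suc N)" by simp
    then have N': "4 / real (Suc N) < e\<^sup>2"
      using e by (simp add: divide_less_eq less_divide_eq mult.commute del: of_nat_Suc)
    have "dist (y m) (y n) < e" if "m \<ge> N" "n \<ge> N" for m n
    proof -
      have "2 / real (Suc m) \<le> 2 / real (Suc N)" "2 / real (Suc n) \<le> 2 / real (Suc N)"
        using that by (auto intro!: divide_left_mono)
      then have "(norm (y m - y n))\<^sup>2 < e\<^sup>2" using par[of m n] N' by linarith
      then show ?thesis using e by (simp add: dist_norm power_less_imp_less_base)
    qed
    then show "\<exists>M. \<forall>m\<ge>M. \<forall>n\<ge>M. dist (y m) (y n) < e" by blast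
  qed
  then obtain p where p: "y \<longlonglongrightarrow> p" using Cauchy_convergent_iff convergent_def by blast
  have pS: "p \<in> S" using S(2) yS p by (rule closed_sequentially)
  define z where "z = x - p"
  have z0: "z \<noteq> 0" using x pS by (auto simp: z_def)
  have "(\<lambda>n. d\<^sup>2 + 1 / real (Suc n)) \<longlonglongrightarrow> d\<^sup>2 + 0"
    by (intro tendsto_add tendsto_const LIMSEQ_inverse_real_of_nat[unfolded inverse_eq_divide])
  moreover have "(\<lambda>n. (norm (x - y n))\<^sup>2) \<longlonglongrightarrow> (norm z)\<^sup>2"
    unfolding z_def by (intro tendsto_intros p)
  ultimately have zd: "(norm z)\<^sup>2 \<le> d\<^sup>2"
    using yd by (intro LIMSEQ_le[of "\<lambda>n. (norm (x - y n))\<^sup>2" _ "\<lambda>n. d\<^sup>2 + 1 / real (Suc n)"])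
      (auto intro: less_imp_le simp del: of_nat_Suc)
  have "s \<bullet> z = 0" if s: "s \<in> S" for s
  proof (cases "s = 0")
    case False
    define t where "t = (s \<bullet> z) / (s \<bullet> s)"
    have ss: "s \<bullet> s > 0" using False by simp
    have "p + t *\<^sub>R s \<in> S" using S(1) pS s by (intro subspace_add subspace_scale)
    then have "d\<^sup>2 \<le> (norm (z - t *\<^sub>R s))\<^sup>2"
      using dle[of "p + t *\<^sub>R s"] d0 by (intro power_mono) (auto simp: z_def algebra_simps)
    also have "\<dots> = (norm z)\<^sup>2 - (s \<bullet> z)\<^sup>2 / (s \<bullet> s)"
      using ss unfolding power2_norm_eq_inner t_def
      by (simp add: inner_diff inner_commute field_simps power2_eq_square)
    finally have "(s \<bullet> z)\<^sup>2 / (s \<bullet> s) \<le> 0" using zd by linarith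
    then show ?thesis using ss by (simp add: divide_le_0_iff)
  qed simp
  then show ?thesis using z0 by blast
qed

lemma closure_subspace:
  fixes S :: "'h::real_normed_vector set"
  assumes S: "subspace S"
  shows "subspace (closure S)"
proof (rule subspaceI)
  show "0 \<in> closure S" using S closure_subset subspace_0 by blast
next
  fix x y assume "x \<in> closure S" "y \<in> closure S"
  then obtain f g where f: "\<And>n. f n \<in> S" "f \<longlonglongrightarrow> x" and g: "\<And>n. g n \<in> S" "g \<longlonglongrightarrow> y"
    by (meson closure_sequential)
  have "\<forall>n. f n + g n \<in> S" using S f(1) g(1) by (simp add: subspace_add)
  then show "x + y \<in> closure S"
    using tendsto_add[OF f(2) g(2)] unfolding closure_sequential
    by (intro exI[of _ "\<lambda>n. f n + g n"] conjI)
next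
  fix c x assume "x \<in> closure S"
  then obtain f where f: "\<And>n. f n \<in> S" "f \<longlonglongrightarrow> x" by (meson closure_sequential)
  have "\<forall>n. c *\<^sub>R f n \<in> S" using S f(1) by (simp add: subspace_scale)
  then show "c *\<^sub>R x \<in> closure S"
    using tendsto_scaleR[OF tendsto_const f(2)] unfolding closure_sequential
    by (intro exI[of _ "\<lambda>n. c *\<^sub>R f n"] conjI)
qed

lemma ex_orthonormal_basis: "\<exists>E::'h::{real_inner,banach} set. orthonormal_basis E"
proof -
  let ?A = "{E::'h set. pairwise orthogonal E \<and> (\<forall>e\<in>E. norm e = 1)}"
  have "\<exists>U\<in>?A. \<forall>X\<in>C. X \<subseteq> U" if C: "C \<in> chains ?A" for C
  proof (intro bexI[of _ "\<Union>C"] ballI)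
    show "\<Union>C \<in> ?A"
    proof -
      have CA: "C \<subseteq> ?A" and ch: "\<And>X Y. X \<in> C \<Longrightarrow> Y \<in> C \<Longrightarrow> X \<subseteq> Y \<or> Y \<subseteq> X"
        using C by (auto simp: chains_def chain_subset_def)
      have "orthogonal a b" if ab: "a \<in> X" "X \<in> C" "b \<in> Y" "Y \<in> C" "a \<noteq> b" for a b X Y
      proof -
        obtain Z where "Z \<in> C" "a \<in> Z" "b \<in> Z" using ch[of X Y] ab by blast
        then show ?thesis using CA ab(5) by (auto simp: pairwise_def)
      qed
      then show ?thesis using CA by (auto simp: pairwise_def)
    qed
  qed auto
  then have "\<exists>B\<in>?A. \<forall>X\<in>?A. B \<subseteq> X \<longrightarrow> X = B"
    by (intro Zorn_Lemma2 ballI)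
  then obtain B where B: "B \<in> ?A" and mx: "\<And>X. X \<in> ?A \<Longrightarrow> B \<subseteq> X \<Longrightarrow> X = B"
    by (elim bexE) (rule that, assumption, simp only: simp_thms)
  have "closure (span B) = UNIV"
  proof (rule ccontr)
    assume "closure (span B) \<noteq> UNIV"
    then obtain x where "x \<notin> closure (span B)" by blast
    then obtain z where z: "z \<noteq> 0" "\<And>s. s \<in> closure (span B) \<Longrightarrow> s \<bullet> z = 0"
      using ex_orthogonal_to_closed_subspace[OF closure_subspace[OF subspace_span] closed_closure]
      by blast
    have zB: "b \<bullet> z = 0" if "b \<in> B" for b
      using z(2) that closure_subset span_base by blast
    define u where "u = z /\<^sub>R norm z"
    have "norm u = 1" using z(1) by (simp add: u_def)
    moreover have "orthogonal b u" "orthogonal u b" if "b \<in> B" for b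
      using zB[OF that] by (simp_all add: orthogonal_def u_def inner_commute)
    ultimately have "insert u B \<in> ?A"
      using B by (auto simp: pairwise_insert)
    then have "u \<in> B" using mx by blast
    then have "u \<bullet> z = 0" by (rule zB)
    then show False using z(1) by (simp add: u_def)
  qed
  then show ?thesis using B unfolding orthonormal_basis_def by blast
qed

text \<open>The library defines \<^const>\<open>adjoint\<close> by choice; this is its characteristic property.\<close>

lemma adjoint_bounded_linear:
  fixes T :: "'h::{real_inner,banach} \<Rightarrow> 'k::real_inner"
  assumes T: "bounded_linear T"
  shows "T x \<bullet> y = x \<bullet> adjoint T y"
proof -
  interpret T: bounded_linear T by (rule T)
  have "\<exists>w. \<forall>x. T x \<bullet> y = x \<bullet> w" for y
  proof (cases "\<forall>x. T x \<bullet> y = 0")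
    case True
    then show ?thesis by (intro exI[of _ 0]) simp
  next
    case False
    let ?S = "{x. T x \<bullet> y = 0}"
    have "subspace ?S" by (auto simp: subspace_def T.add T.scaleR inner_add_left T.zero)
    moreover have "closed ?S"
      by (intro closed_Collect_eq continuous_intros T.continuous_on)
    ultimately obtain z where z: "z \<noteq> 0" "\<And>s. s \<in> ?S \<Longrightarrow> s \<bullet> z = 0"
      using ex_orthogonal_to_closed_subspace[of ?S] False by blast
    have zz: "z \<bullet> z \<noteq> 0" using z(1) by simp
    then have Tz: "T z \<bullet> y \<noteq> 0" using z(2)[of z] by blast
    have "T x \<bullet> y = x \<bullet> (((T z \<bullet> y) / (z \<bullet> z)) *\<^sub>R z)" for x
    proof -
      have "x - ((T x \<bullet> y) / (T z \<bullet> y)) *\<^sub>R z \<in> ?S"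
        using Tz by (simp add: T.diff T.scaleR inner_diff_left)
      from z(2)[OF this] have "x \<bullet> z = ((T x \<bullet> y) / (T z \<bullet> y)) * (z \<bullet> z)"
        by (simp add: inner_diff_left)
      then show ?thesis using Tz zz by simp
    qed
    then show ?thesis by blast
  qed
  then have "\<exists>f. \<forall>x y. T x \<bullet> y = x \<bullet> f y" by metis
  then have "\<forall>x y. T x \<bullet> y = x \<bullet> adjoint T y" unfolding adjoint_def by (rule someI_ex)
  then show ?thesis by blast
qed

end

theory Submission
  imports Defs
begin

text \<open>
  Only the isometry and the surjectivity of \<open>v \<mapsto> H\<^sub>v\<close> need work.  Naturality is the identity
  \<open>\<langle>T (v \<omega>), y\<rangle> = \<langle>v \<omega>, T\<^sup>* y\<rangle>\<close> on representatives.  The space of Hilbert-Schmidt operators is a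
  Hilbert space, and \<open>H \<mapsto> H T\<^sup>*\<close> is bounded on it, because both properties can be carried over from
  \<open>L\<^sup>2\<close> along the bijection (\<open>hilbert_space_transport\<close>, \<open>hbounded_linear_HS_map\<close>).

  Neither the measure nor the Hilbert space is restricted in size, so an orthonormal basis may be
  uncountable and the integral cannot simply be exchanged with the sum of Parseval's identity.
  Instead, a function in \<open>L\<^sup>2\<close> is approximated by a simple function with values in the linear span
  of the basis (\<open>square_integrable_simple_approx\<close>).  Such a function involves only finitely many
  basis vectors, and the projection onto their span is a pointwise best approximation; this yields
  the integrated Parseval identity \<open>has_sum_integral_norm_squared\<close>, and by polarization the
  isometry, for every orthonormal basis.

  For surjectivity, choose representatives \<open>a\<^sub>e\<close> of the values \<open>A e\<close> of a Hilbert-Schmidt operator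
  on an orthonormal basis.  The finite partial sums of \<open>\<Sum> a\<^sub>e e\<close> form a Cauchy net in \<open>L\<^sup>2\<close>,
  because their differences are controlled by tails of \<open>\<Sum> \<parallel>A e\<parallel>\<^sup>2\<close>; the limit exists since \<open>L\<^sup>2\<close> is complete
  (\<open>square_integrable_Cauchy_convergent\<close>), and its operator agrees with \<open>A\<close> on the basis, hence by
  linearity and continuity everywhere.

  Completeness of the measure makes functions that are almost everywhere equal to measurable ones
  measurable.  Thus the measurability of an integrand does not depend on the representative, and for
  real functions Bochner and Borel measurability coincide.
\<close>


section \<open>Bochner measurability through simple functions\<close>

text \<open>
  Preimages under the two functions differ by a subset of a null set, which a complete measure
  measures.
\<close>

lemma (in complete_measure) measurable_cong_AE_complete:
  assumes f: "f \<in> measurable M N" and g: "g \<in> space M \<rightarrow> space N" and ae: "AE \<omega> in M. f \<omega> = g \<omega>"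
  shows "g \<in> measurable M N"
proof (rule measurableI)
  fix A assume A: "A \<in> sets N"
  have "AE \<omega> in M. \<omega> \<in> f -` A \<inter> space M \<longleftrightarrow> \<omega> \<in> g -` A \<inter> space M"
    using ae by eventually_elim auto
  then show "g -` A \<inter> space M \<in> sets M"
    by (rule in_sets_AE) (use f A in auto)
qed (use g in auto)

text \<open>
  The closure properties of \<^const>\<open>simple_function\<close> hold for arbitrary target types, so they
  become available for functions into non-separable spaces.
\<close>

lemma bochner_simple_iff:
  fixes v :: "'a \<Rightarrow> 'h::real_normed_vector"
  shows "bochner_simple M v \<longleftrightarrow> (\<exists>s. simple_function M s \<and> (AE \<omega> in M. s \<omega> = v \<omega>))"
proof
  assume "bochner_simple M v"
  then obtain N :: nat and E e where E: "\<And>n. n < N \<Longrightarrow> E n \<in> sets M"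
    and v: "AE \<omega> in M. v \<omega> = (\<Sum>n<N. indicator (E n) \<omega> *\<^sub>R e n)"
    unfolding bochner_simple_def by blast
  have "simple_function M (\<lambda>\<omega>. \<Sum>n<N. indicator (E n) \<omega> *\<^sub>R e n)"
    by (intro simple_function_sum simple_function_compose2[where h="\<lambda>a b. a *\<^sub>R b"]
        simple_function_const simple_function_indicator) (auto intro: E)
  moreover have "AE \<omega> in M. (\<Sum>n<N. indicator (E n) \<omega> *\<^sub>R e n) = v \<omega>"
    using v by eventually_elim simp
  ultimately show "\<exists>s. simple_function M s \<and> (AE \<omega> in M. s \<omega> = v \<omega>)" by (intro exI conjI)
next
  assume "\<exists>s. simple_function M s \<and> (AE \<omega> in M. s \<omega> = v \<omega>)"
  then obtain s where s: "simple_function M s" "AE \<omega> in M. s \<omega> = v \<omega>" by blast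
  have "finite (s ` space M)" using s(1) by (rule simple_functionD)
  then obtain e where e: "bij_betw e {0..<card (s ` space M)} (s ` space M)"
    using ex_bij_betw_nat_finite by blast
  let ?N = "card (s ` space M)" and ?E = "\<lambda>n. s -` {e n} \<inter> space M"
  have sum: "s \<omega> = (\<Sum>n<?N. indicator (?E n) \<omega> *\<^sub>R e n)" if \<omega>: "\<omega> \<in> space M" for \<omega>
  proof -
    have "s \<omega> \<in> e ` {0..<?N}" using \<omega> bij_betw_imp_surj_on[OF e] by simp
    then obtain k where k: "k < ?N" "e k = s \<omega>" by auto
    have "(\<Sum>n<?N. indicator (?E n) \<omega> *\<^sub>R e n) = (\<Sum>n<?N. if n = k then s \<omega> else 0)"
    proof (rule sum.cong)
      fix n assume "n \<in> {..<?N}"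
      then have "e n = e k \<longleftrightarrow> n = k"
        using e k(1) by (auto simp: bij_betw_def inj_on_def)
      then show "indicator (?E n) \<omega> *\<^sub>R e n = (if n = k then s \<omega> else 0)"
        using k(2) \<omega> by (auto simp: indicator_def)
    qed simp
    then show ?thesis using k(1) by simp
  qed
  have "AE \<omega> in M. v \<omega> = (\<Sum>n<?N. indicator (?E n) \<omega> *\<^sub>R e n)"
    using s(2) AE_space
  proof eventually_elim
    fix \<omega> assume "s \<omega> = v \<omega>" "\<omega> \<in> space M"
    with sum[of \<omega>] show "v \<omega> = (\<Sum>n<?N. indicator (?E n) \<omega> *\<^sub>R e n)" by simp
  qed
  then show "bochner_simple M v"
    unfolding bochner_simple_def
    by (intro exI[of _ ?N] exI[of _ ?E] exI[of _ e]) (auto intro: simple_functionD[OF s(1)])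
qed

lemma bochner_measurable_iff:
  fixes v :: "'a \<Rightarrow> 'h::real_normed_vector"
  shows "bochner_measurable M v \<longleftrightarrow>
    (\<exists>s. (\<forall>n. simple_function M (s n)) \<and> (AE \<omega> in M. (\<lambda>n. s n \<omega>) \<longlonglongrightarrow> v \<omega>))"
proof
  assume "bochner_measurable M v"
  then obtain t where t: "\<And>n. bochner_simple M (t n)" "AE \<omega> in M. (\<lambda>n. t n \<omega>) \<longlonglongrightarrow> v \<omega>"
    unfolding bochner_measurable_def by blast
  then obtain s where s: "\<And>n. simple_function M (s n)" "\<And>n. AE \<omega> in M. s n \<omega> = t n \<omega>"
    unfolding bochner_simple_iff by metis
  have "AE \<omega> in M. \<forall>n. s n \<omega> = t n \<omega>" using s(2) by (simp add: AE_all_countable)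
  with t(2) have "AE \<omega> in M. (\<lambda>n. s n \<omega>) \<longlonglongrightarrow> v \<omega>" by eventually_elim simp
  with s(1) show "\<exists>s. (\<forall>n. simple_function M (s n)) \<and> (AE \<omega> in M. (\<lambda>n. s n \<omega>) \<longlonglongrightarrow> v \<omega>)"
    by blast
next
  assume "\<exists>s. (\<forall>n. simple_function M (s n)) \<and> (AE \<omega> in M. (\<lambda>n. s n \<omega>) \<longlonglongrightarrow> v \<omega>)"
  then obtain s where s: "\<And>n. simple_function M (s n)" "AE \<omega> in M. (\<lambda>n. s n \<omega>) \<longlonglongrightarrow> v \<omega>" by blast
  have "bochner_simple M (s n)" for n
    unfolding bochner_simple_iff using s(1) by (intro exI[of _ "s n"]) simp
  with s(2) show "bochner_measurable M v"
    unfolding bochner_measurable_def by blast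
qed

lemma bochner_measurable_simple_function: "simple_function M s \<Longrightarrow> bochner_measurable M s"
  unfolding bochner_measurable_iff by (intro exI[of _ "\<lambda>n. s"]) simp

lemma bochner_measurable_AE:
  assumes "bochner_measurable M v" "AE \<omega> in M. v \<omega> = w \<omega>"
  shows "bochner_measurable M w"
proof -
  obtain s where s: "\<And>n. simple_function M (s n)" "AE \<omega> in M. (\<lambda>n. s n \<omega>) \<longlonglongrightarrow> v \<omega>"
    using assms(1) unfolding bochner_measurable_iff by blast
  have "AE \<omega> in M. (\<lambda>n. s n \<omega>) \<longlonglongrightarrow> w \<omega>"
    using s(2) assms(2) by eventually_elim simp
  then show ?thesis unfolding bochner_measurable_iff using s(1) by blast
qed

text \<open>
  Every function of two simple functions is simple, and continuity carries this to the limit.  All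
  pointwise operations are instances.
\<close>

lemma bochner_measurable_continuous2:
  assumes u: "bochner_measurable M u" and v: "bochner_measurable M v"
    and h: "continuous_on UNIV (\<lambda>p. h (fst p) (snd p))"
  shows "bochner_measurable M (\<lambda>\<omega>. h (u \<omega>) (v \<omega>))"
proof -
  obtain s where s: "\<And>n. simple_function M (s n)" "AE \<omega> in M. (\<lambda>n. s n \<omega>) \<longlonglongrightarrow> u \<omega>"
    using u unfolding bochner_measurable_iff by blast
  obtain t where t: "\<And>n. simple_function M (t n)" "AE \<omega> in M. (\<lambda>n. t n \<omega>) \<longlonglongrightarrow> v \<omega>"
    using v unfolding bochner_measurable_iff by blast
  have "AE \<omega> in M. (\<lambda>n. h (s n \<omega>) (t n \<omega>)) \<longlonglongrightarrow> h (u \<omega>) (v \<omega>)"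
    using s(2) t(2)
  proof eventually_elim
    fix \<omega> assume "(\<lambda>n. s n \<omega>) \<longlonglongrightarrow> u \<omega>" "(\<lambda>n. t n \<omega>) \<longlonglongrightarrow> v \<omega>"
    then have "(\<lambda>n. (s n \<omega>, t n \<omega>)) \<longlonglongrightarrow> (u \<omega>, v \<omega>)" by (rule tendsto_Pair)
    from continuous_on_tendsto_compose[OF h this]
    show "(\<lambda>n. h (s n \<omega>) (t n \<omega>)) \<longlonglongrightarrow> h (u \<omega>) (v \<omega>)" by simp
  qed
  then show ?thesis unfolding bochner_measurable_iff
    by (intro exI[of _ "\<lambda>n \<omega>. h (s n \<omega>) (t n \<omega>)"]) (simp add: s(1) t(1) simple_function_compose2)
qed

lemma bochner_measurable_continuous:
  assumes v: "bochner_measurable M v" and g: "continuous_on UNIV g"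
  shows "bochner_measurable M (\<lambda>\<omega>. g (v \<omega>))"
proof (rule bochner_measurable_continuous2[OF v v, where h="\<lambda>x y. g x"])
  show "continuous_on UNIV (\<lambda>p. g (fst p))"
    using continuous_on_compose2[OF g continuous_on_fst[OF continuous_on_id], of UNIV] by simp
qed

lemma bochner_measurable_add:
  "bochner_measurable M u \<Longrightarrow> bochner_measurable M v \<Longrightarrow> bochner_measurable M (\<lambda>\<omega>. u \<omega> + v \<omega>)"
  by (rule bochner_measurable_continuous2[of M u v "(+)"])
    (simp_all add: continuous_on_add continuous_on_fst continuous_on_snd)

lemma bochner_measurable_diff:
  "bochner_measurable M u \<Longrightarrow> bochner_measurable M v \<Longrightarrow> bochner_measurable M (\<lambda>\<omega>. u \<omega> - v \<omega>)"
  by (rule bochner_measurable_continuous2[of M u v "(-)"])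
    (simp_all add: continuous_on_diff continuous_on_fst continuous_on_snd)

text \<open>
  The identification of the two descriptions of \<open>L\<^sup>2(\<Omega>)\<close> rests on this.  An almost everywhere
  limit of simple functions agrees with an everywhere defined measurable limit only up to a null
  set, so completeness enters in the forward direction.
\<close>

lemma (in complete_measure) bochner_measurable_real_iff:
  fixes f :: "'a \<Rightarrow> real"
  shows "bochner_measurable M f \<longleftrightarrow> f \<in> borel_measurable M"
proof
  assume "bochner_measurable M f"
  then obtain s where s: "\<And>n. simple_function M (s n)" "AE \<omega> in M. (\<lambda>n. s n \<omega>) \<longlonglongrightarrow> f \<omega>"
    unfolding bochner_measurable_iff by blast
  have [measurable]: "s n \<in> borel_measurable M" for n
    using s(1) by (rule borel_measurable_simple_function)
  have "(\<lambda>\<omega>. lim (\<lambda>n. s n \<omega>)) \<in> borel_measurable M"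
    by measurable
  then show "f \<in> borel_measurable M"
  proof (rule measurable_cong_AE_complete)
    show "AE \<omega> in M. lim (\<lambda>n. s n \<omega>) = f \<omega>"
      using s(2) by eventually_elim (rule limI)
  qed simp
next
  assume "f \<in> borel_measurable M"
  then obtain s where "\<And>n. simple_function M (s n)" "\<And>\<omega>. \<omega> \<in> space M \<Longrightarrow> (\<lambda>n. s n \<omega>) \<longlonglongrightarrow> f \<omega>"
    using borel_measurable_implies_sequence_metric by metis
  then show "bochner_measurable M f"
    unfolding bochner_measurable_iff by (intro exI[of _ s]) auto
qed

lemma (in complete_measure) borel_measurable_norm_bochner:
  "bochner_measurable M v \<Longrightarrow> (\<lambda>\<omega>. norm (v \<omega>)) \<in> borel_measurable M"
  using bochner_measurable_continuous[of M v norm]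
  by (simp add: bochner_measurable_real_iff continuous_on_norm_id)

lemma (in complete_measure) borel_measurable_inner_bochner:
  fixes u v :: "'a \<Rightarrow> 'h::real_inner"
  shows "bochner_measurable M u \<Longrightarrow> bochner_measurable M v \<Longrightarrow> (\<lambda>\<omega>. u \<omega> \<bullet> v \<omega>) \<in> borel_measurable M"
  using bochner_measurable_continuous2[of M u v inner]
  by (simp add: bochner_measurable_real_iff continuous_on_inner continuous_on_fst continuous_on_snd)


section \<open>Square-integrable functions\<close>

definition square_integrable :: "'a measure \<Rightarrow> ('a \<Rightarrow> 'h::real_normed_vector) \<Rightarrow> bool" where
  "square_integrable M v \<longleftrightarrow> bochner_measurable M v \<and> integrable M (\<lambda>\<omega>. (norm (v \<omega>))\<^sup>2)"

context complete_measure
begin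

lemma square_integrable_dominated:
  assumes u: "bochner_measurable M u" and g: "integrable M g" and le: "AE \<omega> in M. (norm (u \<omega>))\<^sup>2 \<le> g \<omega>"
  shows "square_integrable M u"
  unfolding square_integrable_def
proof
  show "integrable M (\<lambda>\<omega>. (norm (u \<omega>))\<^sup>2)"
  proof (rule Bochner_Integration.integrable_bound[OF g])
    show "(\<lambda>\<omega>. (norm (u \<omega>))\<^sup>2) \<in> borel_measurable M"
      using borel_measurable_norm_bochner[OF u] by measurable
    show "AE \<omega> in M. norm ((norm (u \<omega>))\<^sup>2) \<le> norm (g \<omega>)"
      using le by eventually_elim simp
  qed
qed (rule u)

lemma square_integrable_AE:
  assumes v: "square_integrable M v" and ae: "AE \<omega> in M. v \<omega> = w \<omega>"
  shows "square_integrable M w"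
proof (rule square_integrable_dominated)
  show "bochner_measurable M w"
    using v ae by (auto simp: square_integrable_def intro: bochner_measurable_AE)
  show "integrable M (\<lambda>\<omega>. (norm (v \<omega>))\<^sup>2)" using v by (simp add: square_integrable_def)
  show "AE \<omega> in M. (norm (w \<omega>))\<^sup>2 \<le> (norm (v \<omega>))\<^sup>2" using ae by eventually_elim simp
qed

lemma square_integrable_bounded_linear:
  assumes T: "bounded_linear T" and v: "square_integrable M v"
  shows "square_integrable M (\<lambda>\<omega>. T (v \<omega>))"
proof -
  obtain B where B: "\<And>x. norm (T x) \<le> norm x * B" using bounded_linear.bounded[OF T] by blast
  show ?thesis
  proof (rule square_integrable_dominated)
    show "bochner_measurable M (\<lambda>\<omega>. T (v \<omega>))"
      using v linear_continuous_on[OF T]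
      by (intro bochner_measurable_continuous[of M v T]) (simp_all add: square_integrable_def)
    show "integrable M (\<lambda>\<omega>. B\<^sup>2 * (norm (v \<omega>))\<^sup>2)" using v by (simp add: square_integrable_def)
    show "AE \<omega> in M. (norm (T (v \<omega>)))\<^sup>2 \<le> B\<^sup>2 * (norm (v \<omega>))\<^sup>2"
    proof (rule AE_I2)
      fix \<omega>
      have "(norm (T (v \<omega>)))\<^sup>2 \<le> (norm (v \<omega>) * B)\<^sup>2" by (intro power_mono B norm_ge_zero)
      then show "(norm (T (v \<omega>)))\<^sup>2 \<le> B\<^sup>2 * (norm (v \<omega>))\<^sup>2" by (simp add: power_mult_distrib mult.commute)
    qed
  qed
qed

lemma square_integrable_zero: "square_integrable M (\<lambda>\<omega>. 0)"
  by (simp add: square_integrable_def bochner_measurable_simple_function)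

lemma square_integrable_scaleR:
  "square_integrable M v \<Longrightarrow> square_integrable M (\<lambda>\<omega>. a *\<^sub>R v \<omega>)"
  by (rule square_integrable_bounded_linear) (rule bounded_linear_scaleR_right)

lemma square_integrable_inner_const:
  fixes v :: "'a \<Rightarrow> 'h::real_inner"
  shows "square_integrable M v \<Longrightarrow> square_integrable M (\<lambda>\<omega>. v \<omega> \<bullet> x)"
  by (rule square_integrable_bounded_linear) (rule bounded_linear_inner_left)

end

lemma norm_add_squared_le:
  fixes x y :: "'h::real_normed_vector"
  shows "(norm (x + y))\<^sup>2 \<le> 2 * (norm x)\<^sup>2 + 2 * (norm y)\<^sup>2"
proof -
  have "(norm (x + y))\<^sup>2 \<le> (norm x + norm y)\<^sup>2" by (intro power_mono norm_triangle_ineq norm_ge_zero)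
  also have "\<dots> \<le> 2 * (norm x)\<^sup>2 + 2 * (norm y)\<^sup>2"
    using sum_squares_bound[of "norm x" "norm y"] by (simp add: power2_sum)
  finally show ?thesis .
qed

context complete_measure
begin

lemma square_integrable_add:
  assumes u: "square_integrable M u" and v: "square_integrable M v"
  shows "square_integrable M (\<lambda>\<omega>. u \<omega> + v \<omega>)"
proof (rule square_integrable_dominated)
  show "bochner_measurable M (\<lambda>\<omega>. u \<omega> + v \<omega>)"
    using u v by (simp add: square_integrable_def bochner_measurable_add)
  show "integrable M (\<lambda>\<omega>. 2 * (norm (u \<omega>))\<^sup>2 + 2 * (norm (v \<omega>))\<^sup>2)"
    using u v by (simp add: square_integrable_def)
qed (simp add: norm_add_squared_le)

lemma square_integrable_diff:
  assumes u: "square_integrable M u" and v: "square_integrable M v"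
  shows "square_integrable M (\<lambda>\<omega>. u \<omega> - v \<omega>)"
  using square_integrable_add[OF u square_integrable_scaleR[OF v, of "-1"]] by simp

lemma square_integrable_sum:
  "(\<And>i. i \<in> I \<Longrightarrow> square_integrable M (f i)) \<Longrightarrow> square_integrable M (\<lambda>\<omega>. \<Sum>i\<in>I. f i \<omega>)"
  by (induction I rule: infinite_finite_induct) (simp_all add: square_integrable_zero square_integrable_add)

lemma integrable_inner:
  fixes u v :: "'a \<Rightarrow> 'h::real_inner"
  assumes u: "square_integrable M u" and v: "square_integrable M v"
  shows "integrable M (\<lambda>\<omega>. u \<omega> \<bullet> v \<omega>)"
proof (rule Bochner_Integration.integrable_bound)
  show "integrable M (\<lambda>\<omega>. (norm (u \<omega>))\<^sup>2 + (norm (v \<omega>))\<^sup>2)"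
    using u v by (simp add: square_integrable_def)
  show "(\<lambda>\<omega>. u \<omega> \<bullet> v \<omega>) \<in> borel_measurable M"
    using u v by (auto simp: square_integrable_def intro: borel_measurable_inner_bochner)
  show "AE \<omega> in M. norm (u \<omega> \<bullet> v \<omega>) \<le> norm ((norm (u \<omega>))\<^sup>2 + (norm (v \<omega>))\<^sup>2)"
  proof (rule AE_I2)
    fix \<omega>
    have "\<bar>u \<omega> \<bullet> v \<omega>\<bar> \<le> norm (u \<omega>) * norm (v \<omega>)" by (rule Cauchy_Schwarz_ineq2)
    also have "\<dots> \<le> (norm (u \<omega>))\<^sup>2 + (norm (v \<omega>))\<^sup>2"
      using sum_squares_bound[of "norm (u \<omega>)" "norm (v \<omega>)"]
        mult_nonneg_nonneg[OF norm_ge_zero norm_ge_zero, of "u \<omega>" "v \<omega>"] by linarith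
    finally show "norm (u \<omega> \<bullet> v \<omega>) \<le> norm ((norm (u \<omega>))\<^sup>2 + (norm (v \<omega>))\<^sup>2)" by simp
  qed
qed

text \<open>
  This quasi-triangle inequality for the squared norm replaces Minkowski's inequality throughout,
  at the price of constants that are harmless in every limit argument.
\<close>

lemma integral_norm_add_squared_le:
  assumes u: "square_integrable M u" and v: "square_integrable M v"
  shows "(\<integral>\<omega>. (norm (u \<omega> + v \<omega>))\<^sup>2 \<partial>M) \<le> 2 * (\<integral>\<omega>. (norm (u \<omega>))\<^sup>2 \<partial>M) + 2 * (\<integral>\<omega>. (norm (v \<omega>))\<^sup>2 \<partial>M)"
proof -
  have "(\<integral>\<omega>. (norm (u \<omega> + v \<omega>))\<^sup>2 \<partial>M) \<le> (\<integral>\<omega>. 2 * (norm (u \<omega>))\<^sup>2 + 2 * (norm (v \<omega>))\<^sup>2 \<partial>M)"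
    using u v square_integrable_add[OF u v]
    by (intro integral_mono norm_add_squared_le) (auto simp: square_integrable_def)
  also have "\<dots> = 2 * (\<integral>\<omega>. (norm (u \<omega>))\<^sup>2 \<partial>M) + 2 * (\<integral>\<omega>. (norm (v \<omega>))\<^sup>2 \<partial>M)"
    using u v by (simp add: square_integrable_def)
  finally show ?thesis .
qed

lemma integral_norm_squared_eq_0_iff:
  assumes "square_integrable M v"
  shows "(\<integral>\<omega>. (norm (v \<omega>))\<^sup>2 \<partial>M) = 0 \<longleftrightarrow> (AE \<omega> in M. v \<omega> = 0)"
  using assms by (subst integral_nonneg_eq_0_iff_AE) (auto simp: square_integrable_def)

end


section \<open>Density of simple functions and completeness\<close>

context complete_measure
begin

lemma borel_measurable_norm_squared:
  "square_integrable M u \<Longrightarrow> (\<lambda>\<omega>. (norm (u \<omega>))\<^sup>2) \<in> borel_measurable M"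
  unfolding square_integrable_def by (blast intro: borel_measurable_integrable)

text \<open>
  A simple function stays simple under a map that moves each point to a nearby point of the dense
  set \<open>D\<close>, however irregular that map is.  Cutting off where the approximation exceeds \<open>2 \<parallel>u\<parallel>\<close> gives an
  integrable bound without affecting the limit.  Completeness of \<open>L\<^sup>2\<close> uses \<open>D = UNIV\<close>, Parseval's
  identity the span of a basis.
\<close>

lemma square_integrable_simple_approx:
  fixes u :: "'a \<Rightarrow> 'h::real_normed_vector"
  assumes u: "square_integrable M u" and D: "closure D = UNIV" "0 \<in> D" and \<epsilon>: "0 < \<epsilon>"
  obtains w where "simple_function M w" "range w \<subseteq> D" "square_integrable M w"
    "(\<integral>\<omega>. (norm (u \<omega> - w \<omega>))\<^sup>2 \<partial>M) < \<epsilon>"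
proof -
  obtain s where s: "\<And>n. simple_function M (s n)" "AE \<omega> in M. (\<lambda>n. s n \<omega>) \<longlonglongrightarrow> u \<omega>"
    using u unfolding square_integrable_def bochner_measurable_iff by blast
  have "\<exists>d\<in>D. dist d y < inverse (real (Suc n))" for n and y :: 'h
  proof -
    have "y \<in> closure D" by (simp add: D(1))
    then show ?thesis unfolding closure_approachable by simp
  qed
  then have "\<exists>g. \<forall>n y. g n y \<in> D \<and> dist (g n y) y < inverse (real (Suc n))"
    by (intro choice allI) blast
  then obtain g where g: "\<And>n y. g n y \<in> D" "\<And>n y. dist (g n y) y < inverse (real (Suc n))"
    by blast
  \<comment> \<open>Pointwise the values are moved by less than \<open>1 / (n + 1)\<close>, so the limit is unchanged.\<close>
  define t where "t n \<omega> = g n (s n \<omega>)" for n \<omega>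
  have t: "simple_function M (t n)" for n
    unfolding t_def using s(1) by (rule simple_function_compose1)
  have t_lim: "AE \<omega> in M. (\<lambda>n. t n \<omega>) \<longlonglongrightarrow> u \<omega>"
    using s(2)
  proof eventually_elim
    fix \<omega> assume lim: "(\<lambda>n. s n \<omega>) \<longlonglongrightarrow> u \<omega>"
    have "(\<lambda>n. t n \<omega> - s n \<omega>) \<longlonglongrightarrow> 0"
      by (rule Lim_null_comparison[OF _ LIMSEQ_inverse_real_of_nat])
        (use g(2) in \<open>auto simp: t_def dist_norm intro!: always_eventually less_imp_le\<close>)
    from tendsto_add[OF this lim] show "(\<lambda>n. t n \<omega>) \<longlonglongrightarrow> u \<omega>" by simp
  qed
  define w where "w n \<omega> = (if norm (t n \<omega>) \<le> 2 * norm (u \<omega>) then t n \<omega> else 0)" for n \<omega>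
  have w: "simple_function M (w n)" for n
    unfolding w_def
  proof (rule simple_function_If)
    have [measurable]: "(\<lambda>\<omega>. norm (u \<omega>)) \<in> borel_measurable M"
      using u by (auto simp: square_integrable_def intro: borel_measurable_norm_bochner)
    have [measurable]: "(\<lambda>\<omega>. norm (t n \<omega>)) \<in> borel_measurable M"
      by (rule borel_measurable_simple_function[OF simple_function_compose1[OF t]])
    show "{\<omega> \<in> space M. norm (t n \<omega>) \<le> 2 * norm (u \<omega>)} \<in> sets M" by measurable
  qed (simp_all add: t)
  have w_le: "norm (w n \<omega>) \<le> 2 * norm (u \<omega>)" for n \<omega>
    by (simp add: w_def)
  have w_le2: "(norm (w n \<omega>))\<^sup>2 \<le> 4 * (norm (u \<omega>))\<^sup>2" for n \<omega>
    using power_mono[OF w_le[of n \<omega>], of 2] by (simp add: power_mult_distrib)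
  have sq_w: "square_integrable M (w n)" for n
    by (rule square_integrable_dominated[where g="\<lambda>\<omega>. 4 * (norm (u \<omega>))\<^sup>2"])
      (use u w w_le2 in \<open>auto simp: square_integrable_def bochner_measurable_simple_function\<close>)
  have w_lim: "AE \<omega> in M. (\<lambda>n. w n \<omega>) \<longlonglongrightarrow> u \<omega>"
    using t_lim
  proof eventually_elim
    fix \<omega> assume lim: "(\<lambda>n. t n \<omega>) \<longlonglongrightarrow> u \<omega>"
    show "(\<lambda>n. w n \<omega>) \<longlonglongrightarrow> u \<omega>"
    proof (cases "u \<omega> = 0")
      case True
      \<comment> \<open>At a zero of \<open>u\<close> the cut-off leaves only the value \<open>0\<close>.\<close>
      then have "w n \<omega> = 0" for n using w_le[of n \<omega>] by simp
      then show ?thesis using True by simp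
    next
      case False
      then have "norm (u \<omega>) < 2 * norm (u \<omega>)" by simp
      with tendsto_norm[OF lim] have "eventually (\<lambda>n. norm (t n \<omega>) < 2 * norm (u \<omega>)) sequentially"
        by (rule order_tendstoD)
      then have "eventually (\<lambda>n. t n \<omega> = w n \<omega>) sequentially"
        by eventually_elim (simp add: w_def)
      with lim show ?thesis by (rule Lim_transform_eventually)
    qed
  qed
  have "(\<lambda>n. \<integral>\<omega>. (norm (u \<omega> - w n \<omega>))\<^sup>2 \<partial>M) \<longlonglongrightarrow> (\<integral>\<omega>. 0 \<partial>M)"
  proof (rule integral_dominated_convergence[where w="\<lambda>\<omega>. 10 * (norm (u \<omega>))\<^sup>2"])
    show "(\<lambda>\<omega>. (norm (u \<omega> - w n \<omega>))\<^sup>2) \<in> borel_measurable M" for n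
      by (rule borel_measurable_norm_squared[OF square_integrable_diff[OF u sq_w]])
    show "integrable M (\<lambda>\<omega>. 10 * (norm (u \<omega>))\<^sup>2)" using u by (simp add: square_integrable_def)
    show "AE \<omega> in M. (\<lambda>n. (norm (u \<omega> - w n \<omega>))\<^sup>2) \<longlonglongrightarrow> 0"
      using w_lim
    proof eventually_elim
      fix \<omega> assume "(\<lambda>n. w n \<omega>) \<longlonglongrightarrow> u \<omega>"
      then have "(\<lambda>n. (norm (u \<omega> - w n \<omega>))\<^sup>2) \<longlonglongrightarrow> (norm (u \<omega> - u \<omega>))\<^sup>2"
        by (intro tendsto_intros)
      then show "(\<lambda>n. (norm (u \<omega> - w n \<omega>))\<^sup>2) \<longlonglongrightarrow> 0" by simp
    qed
    show "AE \<omega> in M. norm ((norm (u \<omega> - w n \<omega>))\<^sup>2) \<le> 10 * (norm (u \<omega>))\<^sup>2" for n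
    proof (rule AE_I2)
      fix \<omega>
      show "norm ((norm (u \<omega> - w n \<omega>))\<^sup>2) \<le> 10 * (norm (u \<omega>))\<^sup>2"
        using norm_add_squared_le[of "u \<omega>" "- w n \<omega>"] w_le2[of n \<omega>] by simp
    qed
  qed simp
  then have "eventually (\<lambda>n. (\<integral>\<omega>. (norm (u \<omega> - w n \<omega>))\<^sup>2 \<partial>M) < \<epsilon>) sequentially"
    using \<epsilon> by (intro order_tendstoD) simp_all
  then obtain n where n: "(\<integral>\<omega>. (norm (u \<omega> - w n \<omega>))\<^sup>2 \<partial>M) < \<epsilon>"
    unfolding eventually_sequentially by blast
  have "range (w n) \<subseteq> D" using g(1) D(2) by (auto simp: w_def t_def)
  then show thesis using that w sq_w n by blast
qed

text \<open>
  Since the squared increments decay like \<open>4\<^sup>-\<^sup>k\<close> in the mean, they remain summable after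
  multiplication by \<open>2\<^sup>k\<close>; almost everywhere the weighted series converges, and then the increments
  themselves are absolutely summable.
\<close>

lemma AE_convergent_of_fast_Cauchy:
  fixes s :: "nat \<Rightarrow> 'a \<Rightarrow> 'h::banach"
  assumes s: "\<And>k. square_integrable M (s k)"
    and bound: "\<And>k. (\<integral>\<omega>. (norm (s (Suc k) \<omega> - s k \<omega>))\<^sup>2 \<partial>M) \<le> C * (1/4) ^ k"
  shows "AE \<omega> in M. convergent (\<lambda>k. s k \<omega>)"
proof -
  define d where "d k \<omega> = s (Suc k) \<omega> - s k \<omega>" for k \<omega>
  have int: "integrable M (\<lambda>\<omega>. 2 ^ k * (norm (d k \<omega>))\<^sup>2)" for k
    using square_integrable_diff[OF s s] by (simp add: d_def square_integrable_def)
  have [measurable]: "(\<lambda>\<omega>. 2 ^ k * (norm (d k \<omega>))\<^sup>2) \<in> borel_measurable M" for k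
    using int by (rule borel_measurable_integrable)
  have "(\<integral>\<^sup>+\<omega>. (\<Sum>k. ennreal (2 ^ k * (norm (d k \<omega>))\<^sup>2)) \<partial>M)
      = (\<Sum>k. \<integral>\<^sup>+\<omega>. ennreal (2 ^ k * (norm (d k \<omega>))\<^sup>2) \<partial>M)"
    by (rule nn_integral_suminf) measurable
  also have "\<dots> \<le> (\<Sum>k. ennreal (C * (1/2) ^ k))"
  proof (intro suminf_le allI)
    fix k
    have "(\<integral>\<^sup>+\<omega>. ennreal (2 ^ k * (norm (d k \<omega>))\<^sup>2) \<partial>M)
        = ennreal (2 ^ k * (\<integral>\<omega>. (norm (d k \<omega>))\<^sup>2 \<partial>M))"
      using int by (subst nn_integral_eq_integral) auto
    also have "\<dots> \<le> ennreal (2 ^ k * (C * (1/4) ^ k))"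
      using bound[of k] by (intro ennreal_leI mult_left_mono) (simp_all add: d_def)
    also have "2 ^ k * (C * (1/4) ^ k) = C * (1/2) ^ k"
      by (simp add: power_divide field_simps flip: power_mult_distrib)
    finally show "(\<integral>\<^sup>+\<omega>. ennreal (2 ^ k * (norm (d k \<omega>))\<^sup>2) \<partial>M) \<le> ennreal (C * (1/2) ^ k)" .
  qed auto
  also have "\<dots> < top"
  proof -
    have "0 \<le> C" using order_trans[OF _ bound[of 0]] by simp
    then have "(\<Sum>k. ennreal (C * (1/2) ^ k)) = ennreal (\<Sum>k. C * (1/2) ^ k)"
      by (intro suminf_ennreal2 summable_mult summable_geometric) simp_all
    then show ?thesis by simp
  qed
  finally have "AE \<omega> in M. (\<Sum>k. ennreal (2 ^ k * (norm (d k \<omega>))\<^sup>2)) \<noteq> \<infinity>"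
    by (intro nn_integral_PInf_AE) auto
  then show ?thesis
  proof eventually_elim
    fix \<omega> assume "(\<Sum>k. ennreal (2 ^ k * (norm (d k \<omega>))\<^sup>2)) \<noteq> \<infinity>"
    then have "summable (\<lambda>k. 2 ^ k * (norm (d k \<omega>))\<^sup>2)"
      by (intro summable_suminf_not_top) simp_all
    then have sum: "summable (\<lambda>k. 2 ^ k * (norm (d k \<omega>))\<^sup>2 + (1/2) ^ k)"
      by (intro summable_add summable_geometric) simp_all
    \<comment> \<open>The inequality \<open>x \<le> 2\<^sup>k x\<^sup>2 + 2\<^sup>-\<^sup>k\<close> compares the increments with two convergent series.\<close>
    have le: "norm (d k \<omega>) \<le> 2 ^ k * (norm (d k \<omega>))\<^sup>2 + (1/2) ^ k" for k
    proof -
      have "0 \<le> (2 ^ k * norm (d k \<omega>) - 1)\<^sup>2 + 2 ^ k * norm (d k \<omega>)" by simp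
      also have "\<dots> = 2 ^ k * (2 ^ k * (norm (d k \<omega>))\<^sup>2 + (1/2) ^ k - norm (d k \<omega>))"
        by (simp add: power2_diff power_mult_distrib power_divide algebra_simps power2_eq_square)
      finally show ?thesis by (simp add: zero_le_mult_iff not_le[THEN iffD2, OF zero_less_power])
    qed
    have "summable (\<lambda>k. d k \<omega>)"
      by (rule summable_norm_cancel, rule summable_comparison_test'[OF sum]) (simp add: le)
    then have "convergent (\<lambda>n. s 0 \<omega> + (\<Sum>k<n. d k \<omega>))"
      unfolding summable_iff_convergent by (intro convergent_add convergent_const)
    moreover have "s 0 \<omega> + (\<Sum>k<n. d k \<omega>) = s n \<omega>" for n
      unfolding d_def by (subst sum_lessThan_telescope) simp
    ultimately show "convergent (\<lambda>k. s k \<omega>)" by simp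
  qed
qed

text \<open>
  The Riesz-Fischer theorem.  The limit must again be Bochner measurable, which for non-separable
  targets does not follow from pointwise convergence of the given sequence alone.  Replacing a fast
  subsequence by nearby simple functions makes the limit Bochner measurable by definition; Fatou's
  lemma then gives convergence in the mean.
\<close>

theorem square_integrable_Cauchy_convergent:
  fixes v :: "nat \<Rightarrow> 'a \<Rightarrow> 'h::banach"
  assumes v: "\<And>n. square_integrable M (v n)"
    and Cauchy: "\<And>\<epsilon>. 0 < \<epsilon> \<Longrightarrow> \<exists>N. \<forall>m\<ge>N. \<forall>n\<ge>N. (\<integral>\<omega>. (norm (v m \<omega> - v n \<omega>))\<^sup>2 \<partial>M) < \<epsilon>"
  obtains u where "square_integrable M u" "(\<lambda>n. \<integral>\<omega>. (norm (v n \<omega> - u \<omega>))\<^sup>2 \<partial>M) \<longlonglongrightarrow> 0"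
proof -
  have "\<forall>k. \<exists>N. \<forall>m\<ge>N. \<forall>n\<ge>N. (\<integral>\<omega>. (norm (v m \<omega> - v n \<omega>))\<^sup>2 \<partial>M) < (1/4) ^ k"
    using Cauchy by simp
  then obtain r where r: "\<And>k m n. r k \<le> m \<Longrightarrow> r k \<le> n \<Longrightarrow>
      (\<integral>\<omega>. (norm (v m \<omega> - v n \<omega>))\<^sup>2 \<partial>M) < (1/4) ^ k"
    by metis
  \<comment> \<open>The summand \<open>k\<close> makes \<open>R\<close> unbounded; the sum of all earlier thresholds makes two consecutive
      indices lie beyond \<open>r k\<close>.\<close>
  define R where "R k = k + (\<Sum>i\<le>k. r i)" for k
  have "r k \<le> (\<Sum>i\<le>k. r i)" for k by (rule member_le_sum) simp_all
  moreover have "R k \<le> R (Suc k)" for k by (simp add: R_def)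
  ultimately have R: "r k \<le> R k" "r k \<le> R (Suc k)" "k \<le> R k" for k
    unfolding R_def by (meson le_trans le_add1 le_add2)+
  have ex: "\<exists>w. simple_function M w \<and> square_integrable M w \<and>
      (\<integral>\<omega>. (norm (v (R k) \<omega> - w \<omega>))\<^sup>2 \<partial>M) < (1/4) ^ k" for k
  proof -
    have "0 < (1/4::real) ^ k" by simp
    then obtain w where "simple_function M w" "square_integrable M w"
        "(\<integral>\<omega>. (norm (v (R k) \<omega> - w \<omega>))\<^sup>2 \<partial>M) < (1/4) ^ k"
      by (rule square_integrable_simple_approx[OF v[of "R k"] closure_UNIV UNIV_I])
    then show ?thesis by (intro exI[of _ w] conjI)
  qed
  have "\<exists>s. \<forall>k. simple_function M (s k) \<and> square_integrable M (s k) \<and>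
      (\<integral>\<omega>. (norm (v (R k) \<omega> - s k \<omega>))\<^sup>2 \<partial>M) < (1/4) ^ k"
    by (intro choice allI ex)
  then obtain s where s: "\<And>k. simple_function M (s k)" "\<And>k. square_integrable M (s k)"
      "\<And>k. (\<integral>\<omega>. (norm (v (R k) \<omega> - s k \<omega>))\<^sup>2 \<partial>M) < (1/4) ^ k"
    by blast
  have "(\<integral>\<omega>. (norm (s (Suc k) \<omega> - s k \<omega>))\<^sup>2 \<partial>M) \<le> 10 * (1/4) ^ k" for k
  proof -
    let ?a = "\<lambda>\<omega>. s (Suc k) \<omega> - v (R (Suc k)) \<omega>" and ?b = "\<lambda>\<omega>. v (R (Suc k)) \<omega> - v (R k) \<omega>"
      and ?c = "\<lambda>\<omega>. v (R k) \<omega> - s k \<omega>"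
    have abc: "square_integrable M ?a" "square_integrable M ?b" "square_integrable M ?c"
      by (simp_all add: square_integrable_diff v s(2))
    have "(\<integral>\<omega>. (norm (s (Suc k) \<omega> - s k \<omega>))\<^sup>2 \<partial>M) = (\<integral>\<omega>. (norm (?a \<omega> + (?b \<omega> + ?c \<omega>)))\<^sup>2 \<partial>M)"
      by simp
    also have "\<dots> \<le> 2 * (\<integral>\<omega>. (norm (?a \<omega>))\<^sup>2 \<partial>M) + 2 * (\<integral>\<omega>. (norm (?b \<omega> + ?c \<omega>))\<^sup>2 \<partial>M)"
      by (rule integral_norm_add_squared_le[OF abc(1) square_integrable_add[OF abc(2,3)]])
    finally have "(\<integral>\<omega>. (norm (s (Suc k) \<omega> - s k \<omega>))\<^sup>2 \<partial>M)
        \<le> 2 * (\<integral>\<omega>. (norm (?a \<omega>))\<^sup>2 \<partial>M) + 2 * (\<integral>\<omega>. (norm (?b \<omega> + ?c \<omega>))\<^sup>2 \<partial>M)" .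
    moreover have "(\<integral>\<omega>. (norm (?b \<omega> + ?c \<omega>))\<^sup>2 \<partial>M)
        \<le> 2 * (\<integral>\<omega>. (norm (?b \<omega>))\<^sup>2 \<partial>M) + 2 * (\<integral>\<omega>. (norm (?c \<omega>))\<^sup>2 \<partial>M)"
      by (rule integral_norm_add_squared_le[OF abc(2,3)])
    moreover have "(\<integral>\<omega>. (norm (?a \<omega>))\<^sup>2 \<partial>M) < (1/4) ^ Suc k"
      using s(3)[of "Suc k"] by (subst norm_minus_commute)
    moreover have "(1/4) ^ Suc k \<le> (1/4::real) ^ k" by simp
    moreover have "(\<integral>\<omega>. (norm (?b \<omega>))\<^sup>2 \<partial>M) \<le> (1/4) ^ k"
      using r[OF R(2) R(1)] by (rule less_imp_le)
    moreover have "(\<integral>\<omega>. (norm (?c \<omega>))\<^sup>2 \<partial>M) \<le> (1/4) ^ k"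
      using s(3) by (rule less_imp_le)
    ultimately show ?thesis by linarith
  qed
  then have conv: "AE \<omega> in M. convergent (\<lambda>k. s k \<omega>)"
    by (rule AE_convergent_of_fast_Cauchy[OF s(2)])
  define u where "u \<omega> = lim (\<lambda>k. s k \<omega>)" for \<omega>
  have lim: "AE \<omega> in M. (\<lambda>k. s k \<omega>) \<longlonglongrightarrow> u \<omega>"
    using conv by eventually_elim (simp add: u_def convergent_LIMSEQ_iff)
  have bu: "bochner_measurable M u"
    unfolding bochner_measurable_iff using s(1) lim by blast
  have bvu: "bochner_measurable M (\<lambda>\<omega>. v n \<omega> - u \<omega>)" for n
    using v bu by (simp add: square_integrable_def bochner_measurable_diff)
  \<comment> \<open>Each function \<open>s k\<close> with large \<open>k\<close> is close to \<open>v n\<close>, and Fatou's lemma passes to \<open>k \<rightarrow> \<infinity>\<close>.\<close>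
  have Fatou: "\<exists>N. \<forall>n\<ge>N. (\<integral>\<^sup>+\<omega>. ennreal ((norm (v n \<omega> - u \<omega>))\<^sup>2) \<partial>M) \<le> ennreal (4 * \<epsilon>)"
    if \<epsilon>: "0 < \<epsilon>" for \<epsilon>
  proof -
    obtain N where N: "\<And>m n. N \<le> m \<Longrightarrow> N \<le> n \<Longrightarrow> (\<integral>\<omega>. (norm (v m \<omega> - v n \<omega>))\<^sup>2 \<partial>M) < \<epsilon>"
      using Cauchy[OF \<epsilon>] by blast
    have "(\<lambda>k. (1/4::real) ^ k) \<longlonglongrightarrow> 0" by (rule LIMSEQ_power_zero) simp
    then have small: "eventually (\<lambda>k. (1/4::real) ^ k < \<epsilon>) sequentially"
      using \<epsilon> by (rule order_tendstoD)
    have "(\<integral>\<^sup>+\<omega>. ennreal ((norm (v n \<omega> - u \<omega>))\<^sup>2) \<partial>M) \<le> ennreal (4 * \<epsilon>)" if n: "N \<le> n" for n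
    proof -
      have sq: "square_integrable M (\<lambda>\<omega>. v n \<omega> - s k \<omega>)" for k
        by (intro square_integrable_diff v s(2))
      have "(\<integral>\<^sup>+\<omega>. ennreal ((norm (v n \<omega> - u \<omega>))\<^sup>2) \<partial>M)
          = (\<integral>\<^sup>+\<omega>. liminf (\<lambda>k. ennreal ((norm (v n \<omega> - s k \<omega>))\<^sup>2)) \<partial>M)"
      proof (rule nn_integral_cong_AE)
        show "AE \<omega> in M. ennreal ((norm (v n \<omega> - u \<omega>))\<^sup>2)
            = liminf (\<lambda>k. ennreal ((norm (v n \<omega> - s k \<omega>))\<^sup>2))"
          using lim
        proof eventually_elim
          fix \<omega> assume "(\<lambda>k. s k \<omega>) \<longlonglongrightarrow> u \<omega>"
          then have "(\<lambda>k. ennreal ((norm (v n \<omega> - s k \<omega>))\<^sup>2)) \<longlonglongrightarrow> ennreal ((norm (v n \<omega> - u \<omega>))\<^sup>2)"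
            by (intro tendsto_intros tendsto_ennrealI)
          then show "ennreal ((norm (v n \<omega> - u \<omega>))\<^sup>2) = liminf (\<lambda>k. ennreal ((norm (v n \<omega> - s k \<omega>))\<^sup>2))"
            by (intro lim_imp_Liminf[symmetric]) simp_all
        qed
      qed
      also have "\<dots> \<le> liminf (\<lambda>k. \<integral>\<^sup>+\<omega>. ennreal ((norm (v n \<omega> - s k \<omega>))\<^sup>2) \<partial>M)"
        using borel_measurable_norm_squared[OF sq] by (intro nn_integral_liminf) simp
      also have "\<dots> \<le> limsup (\<lambda>k. \<integral>\<^sup>+\<omega>. ennreal ((norm (v n \<omega> - s k \<omega>))\<^sup>2) \<partial>M)"
        by (rule Liminf_le_Limsup) simp
      also have "\<dots> \<le> ennreal (4 * \<epsilon>)"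
      proof (rule Limsup_bounded)
        show "eventually (\<lambda>k. (\<integral>\<^sup>+\<omega>. ennreal ((norm (v n \<omega> - s k \<omega>))\<^sup>2) \<partial>M) \<le> ennreal (4 * \<epsilon>))
            sequentially"
          using small eventually_ge_at_top[of N]
        proof eventually_elim
          fix k assume k: "(1/4) ^ k < \<epsilon>" "N \<le> k"
          have "(\<integral>\<omega>. (norm (v n \<omega> - s k \<omega>))\<^sup>2 \<partial>M)
              = (\<integral>\<omega>. (norm ((v n \<omega> - v (R k) \<omega>) + (v (R k) \<omega> - s k \<omega>)))\<^sup>2 \<partial>M)"
            by simp
          also have "\<dots> \<le> 2 * (\<integral>\<omega>. (norm (v n \<omega> - v (R k) \<omega>))\<^sup>2 \<partial>M)
              + 2 * (\<integral>\<omega>. (norm (v (R k) \<omega> - s k \<omega>))\<^sup>2 \<partial>M)"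
            by (intro integral_norm_add_squared_le square_integrable_diff v s(2))
          also have "\<dots> \<le> 2 * \<epsilon> + 2 * \<epsilon>"
            using N[OF n order_trans[OF k(2) R(3)]] s(3)[of k] k(1) by linarith
          finally show "(\<integral>\<^sup>+\<omega>. ennreal ((norm (v n \<omega> - s k \<omega>))\<^sup>2) \<partial>M) \<le> ennreal (4 * \<epsilon>)"
            using sq[of k] by (subst nn_integral_eq_integral) (auto simp: square_integrable_def intro: ennreal_leI)
        qed
      qed
      finally show ?thesis .
    qed
    then show ?thesis by blast
  qed
  have sq: "square_integrable M (\<lambda>\<omega>. v n \<omega> - u \<omega>)"
    if "(\<integral>\<^sup>+\<omega>. ennreal ((norm (v n \<omega> - u \<omega>))\<^sup>2) \<partial>M) \<le> ennreal c" for n c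
    unfolding square_integrable_def
  proof
    show "integrable M (\<lambda>\<omega>. (norm (v n \<omega> - u \<omega>))\<^sup>2)"
    proof (rule integrableI_nonneg)
      show "(\<lambda>\<omega>. (norm (v n \<omega> - u \<omega>))\<^sup>2) \<in> borel_measurable M"
        using borel_measurable_norm_bochner[OF bvu] by measurable
      show "(\<integral>\<^sup>+\<omega>. ennreal ((norm (v n \<omega> - u \<omega>))\<^sup>2) \<partial>M) < \<infinity>"
        using that by (simp add: order_le_less_trans)
    qed simp
  qed (rule bvu)
  obtain N where "(\<integral>\<^sup>+\<omega>. ennreal ((norm (v N \<omega> - u \<omega>))\<^sup>2) \<partial>M) \<le> ennreal 4"
    using Fatou[of 1] by auto
  from square_integrable_diff[OF v[of N] sq[OF this]] have "square_integrable M u" by simp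
  moreover have "(\<lambda>n. \<integral>\<omega>. (norm (v n \<omega> - u \<omega>))\<^sup>2 \<partial>M) \<longlonglongrightarrow> 0"
  proof (rule LIMSEQ_I)
    fix \<epsilon> :: real assume "0 < \<epsilon>"
    then obtain N where N: "\<And>n. N \<le> n \<Longrightarrow>
        (\<integral>\<^sup>+\<omega>. ennreal ((norm (v n \<omega> - u \<omega>))\<^sup>2) \<partial>M) \<le> ennreal (4 * (\<epsilon> / 8))"
      using Fatou[of "\<epsilon> / 8"] by auto
    have "norm ((\<integral>\<omega>. (norm (v n \<omega> - u \<omega>))\<^sup>2 \<partial>M) - 0) < \<epsilon>" if "N \<le> n" for n
    proof -
      have "ennreal (\<integral>\<omega>. (norm (v n \<omega> - u \<omega>))\<^sup>2 \<partial>M) \<le> ennreal (4 * (\<epsilon> / 8))"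
        using N[OF that] sq[OF N[OF that]]
        by (subst (asm) nn_integral_eq_integral) (auto simp: square_integrable_def)
      then show ?thesis using \<open>0 < \<epsilon>\<close> by (subst (asm) ennreal_le_iff) auto
    qed
    then show "\<exists>N. \<forall>n\<ge>N. norm ((\<integral>\<omega>. (norm (v n \<omega> - u \<omega>))\<^sup>2 \<partial>M) - 0) < \<epsilon>" by blast
  qed
  ultimately show thesis by (rule that)
qed

end


section \<open>Parseval's identity under the integral\<close>

text \<open>
  Completing the square in each coefficient.  The choices \<open>c e = \<langle>x, e\<rangle>\<close>, \<open>c\<close> arbitrary and \<open>x = 0\<close>
  give Bessel's inequality, the best approximation property and Pythagoras' theorem.
\<close>

lemma norm_diff_orthonormal_sum:
  fixes x :: "'h::real_inner"
  assumes "finite F" "pairwise orthogonal F" "\<forall>e\<in>F. norm e = 1"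
  shows "(norm (x - (\<Sum>e\<in>F. c e *\<^sub>R e)))\<^sup>2 = (norm x)\<^sup>2 - (\<Sum>e\<in>F. (x \<bullet> e)\<^sup>2) + (\<Sum>e\<in>F. (x \<bullet> e - c e)\<^sup>2)"
  using assms
proof (induction F rule: finite_induct)
  case (insert a F)
  let ?y = "x - (\<Sum>e\<in>F. c e *\<^sub>R e)"
  have a: "a \<bullet> a = 1" using insert.prems by (simp add: norm_eq_1)
  have "e \<bullet> a = 0" if "e \<in> F" for e
    using insert.prems(1) insert.hyps(2) that by (auto simp: pairwise_insert orthogonal_def)
  then have ya: "?y \<bullet> a = x \<bullet> a" by (simp add: inner_diff_left inner_sum_left)
  have "(norm (x - (\<Sum>e\<in>insert a F. c e *\<^sub>R e)))\<^sup>2 = (norm (?y - c a *\<^sub>R a))\<^sup>2"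
    using insert.hyps by (simp add: algebra_simps)
  also have "\<dots> = (norm ?y)\<^sup>2 - 2 * c a * (?y \<bullet> a) + (c a)\<^sup>2 * (a \<bullet> a)"
  proof -
    have "(norm (y - t *\<^sub>R a))\<^sup>2 = (norm y)\<^sup>2 - 2 * t * (y \<bullet> a) + t\<^sup>2 * (a \<bullet> a)" for y t
      unfolding power2_norm_eq_inner power2_eq_square[of t]
      by (simp add: inner_diff_left inner_diff_right inner_commute algebra_simps)
    then show ?thesis .
  qed
  also have "\<dots> = (norm ?y)\<^sup>2 - (x \<bullet> a)\<^sup>2 + (x \<bullet> a - c a)\<^sup>2"
    by (simp add: ya a power2_diff)
  also have "(norm ?y)\<^sup>2 = (norm x)\<^sup>2 - (\<Sum>e\<in>F. (x \<bullet> e)\<^sup>2) + (\<Sum>e\<in>F. (x \<bullet> e - c e)\<^sup>2)"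
    using insert by (simp add: pairwise_insert)
  finally show ?case using insert.hyps by simp
qed simp

lemma Bessel_inequality:
  fixes x :: "'h::real_inner"
  assumes "finite F" "pairwise orthogonal F" "\<forall>e\<in>F. norm e = 1"
  shows "(\<Sum>e\<in>F. (x \<bullet> e)\<^sup>2) \<le> (norm x)\<^sup>2"
proof -
  have "0 \<le> (norm (x - (\<Sum>e\<in>F. (x \<bullet> e) *\<^sub>R e)))\<^sup>2" by (rule zero_le_power2)
  also have "\<dots> = (norm x)\<^sup>2 - (\<Sum>e\<in>F. (x \<bullet> e)\<^sup>2)"
    by (subst norm_diff_orthonormal_sum[OF assms]) simp
  finally show ?thesis by simp
qed

lemma orthonormal_best_approximation:
  fixes x :: "'h::real_inner"
  assumes F: "finite F" "pairwise orthogonal F" "\<forall>e\<in>F. norm e = 1" and w: "w \<in> span F"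
  shows "(norm x)\<^sup>2 - (\<Sum>e\<in>F. (x \<bullet> e)\<^sup>2) \<le> (norm (x - w))\<^sup>2"
proof -
  obtain c where "w = (\<Sum>e\<in>F. c e *\<^sub>R e)" using w by (auto simp: span_finite[OF F(1)])
  then show ?thesis
    using norm_diff_orthonormal_sum[OF F, of x c] by (simp add: sum_nonneg)
qed

lemma finite_subset_span:
  assumes "finite Y" "Y \<subseteq> span E"
  obtains F where "finite F" "F \<subseteq> E" "Y \<subseteq> span F"
  using assms
proof (induction Y arbitrary: thesis rule: finite_induct)
  case empty
  then show ?case by (meson empty_subsetI finite.emptyI)
next
  case (insert y Y)
  obtain F where F: "finite F" "F \<subseteq> E" "Y \<subseteq> span F" using insert.IH insert.prems by auto
  obtain t c where t: "finite t" "t \<subseteq> E" "y = (\<Sum>a\<in>t. c a *\<^sub>R a)"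
    using insert.prems(2) unfolding span_explicit by auto
  have "y \<in> span t" unfolding t(3) by (intro span_sum span_scale span_base)
  then have "insert y Y \<subseteq> span (F \<union> t)"
    using F(3) span_mono[of F "F \<union> t"] span_mono[of t "F \<union> t"] by auto
  then show ?case using insert.prems(1)[of "F \<union> t"] F t by auto
qed

context complete_measure
begin

text \<open>
  For finite \<open>F\<close> the defect \<open>\<integral>\<parallel>u\<parallel>\<^sup>2 - \<Sum>\<^sub>F \<integral>\<langle>u, e\<rangle>\<^sup>2\<close> is the squared distance in \<open>L\<^sup>2\<close> from \<open>u\<close> to
  the functions with values in the span of \<open>F\<close>.  It is small as soon as \<open>F\<close> contains the finitely
  many basis vectors that occur in a good simple approximation.
\<close>

lemma has_sum_integral_norm_squared:
  fixes u :: "'a \<Rightarrow> 'h::real_inner"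
  assumes E: "orthonormal_basis E" and u: "square_integrable M u"
  shows "((\<lambda>e. \<integral>\<omega>. (u \<omega> \<bullet> e)\<^sup>2 \<partial>M) has_sum (\<integral>\<omega>. (norm (u \<omega>))\<^sup>2 \<partial>M)) E"
  unfolding has_sum_def tendsto_iff
proof (intro allI impI)
  fix \<epsilon> :: real assume \<epsilon>: "0 < \<epsilon>"
  have E': "pairwise orthogonal F" "\<forall>e\<in>F. norm e = 1" if "F \<subseteq> E" for F
    using E that unfolding orthonormal_basis_def by (auto intro: pairwise_mono)
  have int: "integrable M (\<lambda>\<omega>. (norm (u \<omega>))\<^sup>2)" "integrable M (\<lambda>\<omega>. (u \<omega> \<bullet> e)\<^sup>2)" for e
    using u square_integrable_inner_const[OF u, of e] by (simp_all add: square_integrable_def)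
  have eq: "(\<integral>\<omega>. (norm (u \<omega>))\<^sup>2 - (\<Sum>e\<in>F. (u \<omega> \<bullet> e)\<^sup>2) \<partial>M)
      = (\<integral>\<omega>. (norm (u \<omega>))\<^sup>2 \<partial>M) - (\<Sum>e\<in>F. \<integral>\<omega>. (u \<omega> \<bullet> e)\<^sup>2 \<partial>M)" for F
    using int by simp
  obtain w where w: "simple_function M w" "range w \<subseteq> span E" "square_integrable M w"
    "(\<integral>\<omega>. (norm (u \<omega> - w \<omega>))\<^sup>2 \<partial>M) < \<epsilon>"
    using square_integrable_simple_approx[OF u _ span_zero \<epsilon>, of E] E
    unfolding orthonormal_basis_def by blast
  obtain F0 where F0: "finite F0" "F0 \<subseteq> E" "w ` space M \<subseteq> span F0"
    using finite_subset_span[of "w ` space M" E] simple_functionD(1)[OF w(1)] w(2) by blast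
  have "dist (\<Sum>e\<in>F. \<integral>\<omega>. (u \<omega> \<bullet> e)\<^sup>2 \<partial>M) (\<integral>\<omega>. (norm (u \<omega>))\<^sup>2 \<partial>M) < \<epsilon>"
    if F: "finite F" "F0 \<subseteq> F" "F \<subseteq> E" for F
  proof -
    have "0 \<le> (\<integral>\<omega>. (norm (u \<omega>))\<^sup>2 - (\<Sum>e\<in>F. (u \<omega> \<bullet> e)\<^sup>2) \<partial>M)"
      using Bessel_inequality[OF F(1) E'[OF F(3)]] by (intro Bochner_Integration.integral_nonneg) simp
    moreover have "(\<integral>\<omega>. (norm (u \<omega>))\<^sup>2 - (\<Sum>e\<in>F. (u \<omega> \<bullet> e)\<^sup>2) \<partial>M) \<le> (\<integral>\<omega>. (norm (u \<omega> - w \<omega>))\<^sup>2 \<partial>M)"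
    proof (rule integral_mono)
      show "integrable M (\<lambda>\<omega>. (norm (u \<omega>))\<^sup>2 - (\<Sum>e\<in>F. (u \<omega> \<bullet> e)\<^sup>2))" using int by simp
      show "integrable M (\<lambda>\<omega>. (norm (u \<omega> - w \<omega>))\<^sup>2)"
        using square_integrable_diff[OF u w(3)] by (simp add: square_integrable_def)
      fix \<omega> assume "\<omega> \<in> space M"
      then have "w \<omega> \<in> span F" using F0(3) span_mono[OF F(2)] by auto
      then show "(norm (u \<omega>))\<^sup>2 - (\<Sum>e\<in>F. (u \<omega> \<bullet> e)\<^sup>2) \<le> (norm (u \<omega> - w \<omega>))\<^sup>2"
        by (rule orthonormal_best_approximation[OF F(1) E'[OF F(3)]])
    qed
    ultimately show ?thesis using w(4) by (simp add: eq dist_real_def)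
  qed
  then show "eventually (\<lambda>F. dist (\<Sum>e\<in>F. \<integral>\<omega>. (u \<omega> \<bullet> e)\<^sup>2 \<partial>M) (\<integral>\<omega>. (norm (u \<omega>))\<^sup>2 \<partial>M) < \<epsilon>)
      (finite_subsets_at_top E)"
    unfolding eventually_finite_subsets_at_top using F0 by blast
qed

lemma integral_inner_polarization:
  fixes x y :: "'a \<Rightarrow> 'h::real_inner"
  assumes "square_integrable M x" "square_integrable M y"
  shows "(\<integral>\<omega>. x \<omega> \<bullet> y \<omega> \<partial>M)
    = 1/4 * (\<integral>\<omega>. (norm (x \<omega> + y \<omega>))\<^sup>2 \<partial>M) + (- 1/4) * (\<integral>\<omega>. (norm (x \<omega> - y \<omega>))\<^sup>2 \<partial>M)"
proof -
  have "(\<integral>\<omega>. x \<omega> \<bullet> y \<omega> \<partial>M)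
      = (\<integral>\<omega>. 1/4 * (norm (x \<omega> + y \<omega>))\<^sup>2 + (- 1/4) * (norm (x \<omega> - y \<omega>))\<^sup>2 \<partial>M)"
    by (intro Bochner_Integration.integral_cong)
      (simp_all add: power2_norm_eq_inner inner_add inner_diff inner_commute add_divide_distrib diff_divide_distrib)
  also have "\<dots> = 1/4 * (\<integral>\<omega>. (norm (x \<omega> + y \<omega>))\<^sup>2 \<partial>M) + (- 1/4) * (\<integral>\<omega>. (norm (x \<omega> - y \<omega>))\<^sup>2 \<partial>M)"
    using square_integrable_add[OF assms] square_integrable_diff[OF assms]
    by (subst Bochner_Integration.integral_add) (simp_all add: square_integrable_def)
  finally show ?thesis .
qed

lemma has_sum_integral_inner:
  fixes u v :: "'a \<Rightarrow> 'h::real_inner"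
  assumes E: "orthonormal_basis E" and u: "square_integrable M u" and v: "square_integrable M v"
  shows "((\<lambda>e. \<integral>\<omega>. (u \<omega> \<bullet> e) * (v \<omega> \<bullet> e) \<partial>M) has_sum (\<integral>\<omega>. u \<omega> \<bullet> v \<omega> \<partial>M)) E"
proof -
  have "(\<integral>\<omega>. (u \<omega> \<bullet> e) * (v \<omega> \<bullet> e) \<partial>M)
      = 1/4 * (\<integral>\<omega>. ((u \<omega> + v \<omega>) \<bullet> e)\<^sup>2 \<partial>M) + (- 1/4) * (\<integral>\<omega>. ((u \<omega> - v \<omega>) \<bullet> e)\<^sup>2 \<partial>M)" for e
    using integral_inner_polarization[OF square_integrable_inner_const[OF u, of e] square_integrable_inner_const[OF v, of e]]
    by (simp add: inner_add_left inner_diff_left)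
  then show ?thesis
    unfolding integral_inner_polarization[OF u v]
    by (simp only:) (intro has_sum_add has_sum_cmult_right has_sum_integral_norm_squared E
        square_integrable_add square_integrable_diff u v)
qed

end


section \<open>The Hilbert space of classes\<close>

lemma ae_class_mem_iff: "w \<in> ae_class M v \<longleftrightarrow> (AE \<omega> in M. w \<omega> = v \<omega>)"
  by (simp add: ae_class_def)

lemma ae_class_self: "v \<in> ae_class M v"
  by (simp add: ae_class_def)

lemma ae_class_eq_iff: "ae_class M u = ae_class M v \<longleftrightarrow> (AE \<omega> in M. u \<omega> = v \<omega>)"
proof
  assume "ae_class M u = ae_class M v"
  then show "AE \<omega> in M. u \<omega> = v \<omega>" using ae_class_self[of u M] by (simp add: ae_class_mem_iff)
next
  assume uv: "AE \<omega> in M. u \<omega> = v \<omega>"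
  have "(AE \<omega> in M. w \<omega> = u \<omega>) \<longleftrightarrow> (AE \<omega> in M. w \<omega> = v \<omega>)" for w
  proof
    assume "AE \<omega> in M. w \<omega> = u \<omega>"
    then show "AE \<omega> in M. w \<omega> = v \<omega>" using uv by eventually_elim simp
  next
    assume "AE \<omega> in M. w \<omega> = v \<omega>"
    then show "AE \<omega> in M. w \<omega> = u \<omega>" using uv by eventually_elim simp
  qed
  then show "ae_class M u = ae_class M v" by (simp add: ae_class_def)
qed

text \<open>
  Operations on classes are unions over representatives.  When the value does not depend on the
  representative, the union has a single distinct member and can be evaluated at any one of them.
\<close>

lemma UN_ae_class:
  assumes "\<And>w. AE \<omega> in M. w \<omega> = v \<omega> \<Longrightarrow> f w = f v"
  shows "(\<Union>w\<in>ae_class M v. f w) = f v"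
  by (rule UN_constant_eq[OF ae_class_self]) (rule ballI, rule assms, simp add: ae_class_mem_iff)

lemma UN_ae_class2:
  assumes "\<And>u' v'. AE \<omega> in M. u' \<omega> = u \<omega> \<Longrightarrow> AE \<omega> in M. v' \<omega> = v \<omega> \<Longrightarrow> f u' v' = f u v"
  shows "(\<Union>u'\<in>ae_class M u. \<Union>v'\<in>ae_class M v. f u' v') = f u v"
proof -
  have "(\<Union>v'\<in>ae_class M v. f u' v') = f u v" if u': "AE \<omega> in M. u' \<omega> = u \<omega>" for u'
    by (rule UN_constant_eq[OF ae_class_self]) (rule ballI, rule assms[OF u'], simp add: ae_class_mem_iff)
  then show ?thesis
    by (intro UN_constant_eq[OF ae_class_self]) (simp add: ae_class_mem_iff)
qed

lemma hadd_L2: "hadd (L2 M) (ae_class M u) (ae_class M v) = ae_class M (\<lambda>\<omega>. u \<omega> + v \<omega>)"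
proof -
  have *: "ae_class M (\<lambda>\<omega>. u' \<omega> + v' \<omega>) = ae_class M (\<lambda>\<omega>. u \<omega> + v \<omega>)"
    if "AE \<omega> in M. u' \<omega> = u \<omega>" "AE \<omega> in M. v' \<omega> = v \<omega>" for u' v'
    unfolding ae_class_eq_iff using that by eventually_elim simp
  show ?thesis unfolding L2_def L2_of_def hspace.simps by (rule UN_ae_class2) (rule *)
qed

lemma hscale_L2: "hscale (L2 M) a (ae_class M v) = ae_class M (\<lambda>\<omega>. a *\<^sub>R v \<omega>)"
proof -
  have *: "ae_class M (\<lambda>\<omega>. a *\<^sub>R v' \<omega>) = ae_class M (\<lambda>\<omega>. a *\<^sub>R v \<omega>)"
    if "AE \<omega> in M. v' \<omega> = v \<omega>" for v'
    unfolding ae_class_eq_iff using that by eventually_elim simp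
  show ?thesis unfolding L2_def L2_of_def hspace.simps by (rule UN_ae_class) (rule *)
qed

lemma hzero_L2: "hzero (L2 M) = ae_class M (\<lambda>\<omega>. 0)"
  by (simp add: L2_def L2_of_def)

lemma H_op_ae_class: "H_op M (ae_class M v) x = ae_class M (\<lambda>\<omega>. v \<omega> \<bullet> x)"
proof -
  have *: "ae_class M (\<lambda>\<omega>. v' \<omega> \<bullet> x) = ae_class M (\<lambda>\<omega>. v \<omega> \<bullet> x)"
    if "AE \<omega> in M. v' \<omega> = v \<omega>" for v'
    unfolding ae_class_eq_iff using that by eventually_elim simp
  show ?thesis unfolding H_op_def by (rule UN_ae_class) (rule *)
qed

lemma L2_map_ae_class: "L2_map M T (ae_class M v) = ae_class M (\<lambda>\<omega>. T (v \<omega>))"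
proof -
  have *: "ae_class M (\<lambda>\<omega>. T (v' \<omega>)) = ae_class M (\<lambda>\<omega>. T (v \<omega>))"
    if "AE \<omega> in M. v' \<omega> = v \<omega>" for v'
    unfolding ae_class_eq_iff using that by eventually_elim simp
  show ?thesis unfolding L2_map_def by (rule UN_ae_class) (rule *)
qed

lemma hcarrier_L2: "hcarrier (L2 M) = ae_class M ` {v. square_integrable M v}"
  by (simp add: L2_def L2_of_def square_integrable_def)

lemma hcarrier_L2E:
  assumes "V \<in> hcarrier (L2 M)"
  obtains v where "square_integrable M v" "V = ae_class M v"
  using assms by (auto simp: hcarrier_L2)

context complete_measure
begin

lemma L2_real_eq_L2: "L2_real M = L2 M"
  by (simp add: L2_real_def L2_def bochner_measurable_real_iff)

text \<open>
  All integrals over representatives coincide, so the set of their values is the singleton that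
  \<^const>\<open>the_elem\<close> expects.
\<close>

lemma hip_L2:
  assumes u: "square_integrable M u" and v: "square_integrable M v"
  shows "hip (L2 M) (ae_class M u) (ae_class M v) = (\<integral>\<omega>. u \<omega> \<bullet> v \<omega> \<partial>M)"
proof -
  have *: "{\<integral>\<omega>. u' \<omega> \<bullet> v' \<omega> \<partial>M} = {\<integral>\<omega>. u \<omega> \<bullet> v \<omega> \<partial>M}"
    if u': "AE \<omega> in M. u' \<omega> = u \<omega>" and v': "AE \<omega> in M. v' \<omega> = v \<omega>" for u' v'
  proof (rule arg_cong[where f="\<lambda>r. {r}"], rule integral_cong_AE)
    have uu': "AE \<omega> in M. u \<omega> = u' \<omega>" using u' by auto
    have vv': "AE \<omega> in M. v \<omega> = v' \<omega>" using v' by auto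
    have "square_integrable M u'" "square_integrable M v'"
      by (rule square_integrable_AE[OF u uu'], rule square_integrable_AE[OF v vv'])
    then show "(\<lambda>\<omega>. u' \<omega> \<bullet> v' \<omega>) \<in> borel_measurable M"
      by (intro borel_measurable_integrable integrable_inner)
    show "(\<lambda>\<omega>. u \<omega> \<bullet> v \<omega>) \<in> borel_measurable M"
      by (intro borel_measurable_integrable integrable_inner u v)
    show "AE \<omega> in M. u' \<omega> \<bullet> v' \<omega> = u \<omega> \<bullet> v \<omega>"
      using u' v' by eventually_elim simp
  qed
  have "(\<Union>u'\<in>ae_class M u. \<Union>v'\<in>ae_class M v. {\<integral>\<omega>. u' \<omega> \<bullet> v' \<omega> \<partial>M}) = {\<integral>\<omega>. u \<omega> \<bullet> v \<omega> \<partial>M}"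
    by (rule UN_ae_class2) (rule *)
  then show ?thesis unfolding L2_def L2_of_def hspace.simps by (simp only: the_elem_eq)
qed

lemma hip_L2_self:
  "square_integrable M v \<Longrightarrow> hip (L2 M) (ae_class M v) (ae_class M v) = (\<integral>\<omega>. (norm (v \<omega>))\<^sup>2 \<partial>M)"
  by (simp add: hip_L2 power2_norm_eq_inner)

lemma hnorm_L2:
  "square_integrable M v \<Longrightarrow> hnorm (L2 M) (ae_class M v) = sqrt (\<integral>\<omega>. (norm (v \<omega>))\<^sup>2 \<partial>M)"
  by (simp add: hnorm_def hip_L2_self)

lemma hdist_L2:
  "square_integrable M u \<Longrightarrow> square_integrable M v \<Longrightarrow>
    hdist (L2 M) (ae_class M u) (ae_class M v) = sqrt (\<integral>\<omega>. (norm (u \<omega> - v \<omega>))\<^sup>2 \<partial>M)"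
  by (simp add: hdist_def hscale_L2 hadd_L2 hnorm_L2 square_integrable_diff)

theorem hilbert_space_L2: "hilbert_space (L2 M :: ('a \<Rightarrow> 'h::{real_inner,banach}) set hspace)"
proof
  fix x y z :: "('a \<Rightarrow> 'h) set" and a b :: real
  note L2_ops = hadd_L2 hscale_L2 hzero_L2
  show "hzero (L2 M) \<in> hcarrier (L2 M :: ('a \<Rightarrow> 'h) set hspace)"
    by (auto simp: hcarrier_L2 hzero_L2 square_integrable_zero)
  assume "x \<in> hcarrier (L2 M)"
  then obtain u where u: "square_integrable M u" "x = ae_class M u" by (rule hcarrier_L2E)
  show "hscale (L2 M) a x \<in> hcarrier (L2 M)"
    using u by (auto simp: hcarrier_L2 hscale_L2 square_integrable_scaleR)
  show "hadd (L2 M) x (hzero (L2 M)) = x" "hadd (L2 M) x (hscale (L2 M) (- 1) x) = hzero (L2 M)"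
    "hscale (L2 M) (a + b) x = hadd (L2 M) (hscale (L2 M) a x) (hscale (L2 M) b x)"
    "hscale (L2 M) a (hscale (L2 M) b x) = hscale (L2 M) (a * b) x" "hscale (L2 M) 1 x = x"
    by (simp_all add: u(2) L2_ops scaleR_add_left)
  show "0 \<le> hip (L2 M) x x" by (simp add: u hip_L2_self)
  show "x = hzero (L2 M)" if "hip (L2 M) x x = 0"
    using that by (simp add: u hip_L2_self integral_norm_squared_eq_0_iff hzero_L2 ae_class_eq_iff)
  assume "y \<in> hcarrier (L2 M)"
  then obtain v where v: "square_integrable M v" "y = ae_class M v" by (rule hcarrier_L2E)
  show "hadd (L2 M) x y \<in> hcarrier (L2 M)"
    using u v by (auto simp: hcarrier_L2 hadd_L2 square_integrable_add)
  show "hadd (L2 M) x y = hadd (L2 M) y x"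
    "hscale (L2 M) a (hadd (L2 M) x y) = hadd (L2 M) (hscale (L2 M) a x) (hscale (L2 M) a y)"
    by (simp_all add: u(2) v(2) L2_ops add.commute scaleR_add_right)
  show "hip (L2 M) x y = hip (L2 M) y x" "hip (L2 M) (hscale (L2 M) a x) y = a * hip (L2 M) x y"
    by (simp_all add: u v hscale_L2 hip_L2 square_integrable_scaleR inner_commute)
  assume "z \<in> hcarrier (L2 M)"
  then obtain w where w: "square_integrable M w" "z = ae_class M w" by (rule hcarrier_L2E)
  show "hadd (L2 M) (hadd (L2 M) x y) z = hadd (L2 M) x (hadd (L2 M) y z)"
    by (simp add: u(2) v(2) w(2) hadd_L2 add.assoc)
  show "hip (L2 M) (hadd (L2 M) x y) z = hip (L2 M) x z + hip (L2 M) y z"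
    by (simp add: u v w hadd_L2 hip_L2 square_integrable_add inner_add_left integrable_inner)
next
  fix s :: "nat \<Rightarrow> ('a \<Rightarrow> 'h) set"
  assume s: "range s \<subseteq> hcarrier (L2 M)"
    and Cauchy: "\<And>\<epsilon>. 0 < \<epsilon> \<Longrightarrow> \<exists>N. \<forall>m\<ge>N. \<forall>n\<ge>N. hdist (L2 M) (s m) (s n) < \<epsilon>"
  have "\<exists>v. square_integrable M v \<and> s n = ae_class M v" for n
    using s by (auto simp: hcarrier_L2)
  then obtain v where v: "\<And>n. square_integrable M (v n)" "\<And>n. s n = ae_class M (v n)" by metis
  obtain u where u: "square_integrable M u" "(\<lambda>n. \<integral>\<omega>. (norm (v n \<omega> - u \<omega>))\<^sup>2 \<partial>M) \<longlonglongrightarrow> 0"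
  proof (rule square_integrable_Cauchy_convergent[OF v(1)])
    fix \<epsilon> :: real assume "0 < \<epsilon>"
    then show "\<exists>N. \<forall>m\<ge>N. \<forall>n\<ge>N. (\<integral>\<omega>. (norm (v m \<omega> - v n \<omega>))\<^sup>2 \<partial>M) < \<epsilon>"
      using Cauchy[of "sqrt \<epsilon>"] by (simp add: v hdist_L2)
  qed
  have "(\<lambda>n. hdist (L2 M) (s n) (ae_class M u)) \<longlonglongrightarrow> 0"
    using tendsto_real_sqrt[OF u(2)] by (simp add: v hdist_L2 u(1))
  then show "\<exists>x\<in>hcarrier (L2 M). (\<lambda>n. hdist (L2 M) (s n) x) \<longlonglongrightarrow> 0"
    using u(1) by (auto simp: hcarrier_L2)
qed

lemma hbounded_linear_L2_map:
  fixes T :: "'h::{real_inner,banach} \<Rightarrow> 'k::{real_inner,banach}"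
  assumes T: "bounded_linear T"
  shows "hbounded_linear (L2 M) (L2 M) (L2_map M T)"
  unfolding hbounded_linear_def hlinear_def
proof (intro conjI ballI allI)
  interpret T: bounded_linear T by (rule T)
  obtain B where B: "\<And>x. norm (T x) \<le> norm x * B" using T.bounded by blast
  have "hnorm (L2 M) (L2_map M T V) \<le> \<bar>B\<bar> * hnorm (L2 M) V" if "V \<in> hcarrier (L2 M)" for V :: "('a \<Rightarrow> 'h) set"
  proof -
    obtain v where v: "square_integrable M v" "V = ae_class M v" using \<open>V \<in> hcarrier (L2 M)\<close>
      by (rule hcarrier_L2E)
    note Tv = square_integrable_bounded_linear[OF T v(1)]
    have "(\<integral>\<omega>. (norm (T (v \<omega>)))\<^sup>2 \<partial>M) \<le> (\<integral>\<omega>. B\<^sup>2 * (norm (v \<omega>))\<^sup>2 \<partial>M)"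
    proof (rule integral_mono)
      fix \<omega>
      show "(norm (T (v \<omega>)))\<^sup>2 \<le> B\<^sup>2 * (norm (v \<omega>))\<^sup>2"
        using power_mono[OF B, of "v \<omega>" 2] by (simp add: power_mult_distrib mult.commute)
    qed (use v(1) Tv in \<open>simp_all add: square_integrable_def\<close>)
    then have "sqrt (\<integral>\<omega>. (norm (T (v \<omega>)))\<^sup>2 \<partial>M) \<le> sqrt (B\<^sup>2 * (\<integral>\<omega>. (norm (v \<omega>))\<^sup>2 \<partial>M))"
      by simp
    then show ?thesis using v Tv by (simp add: L2_map_ae_class hnorm_L2 real_sqrt_mult)
  qed
  then show "\<exists>B. \<forall>V\<in>hcarrier (L2 M). hnorm (L2 M) (L2_map M T V) \<le> B * hnorm (L2 M) V" by blast
  fix V :: "('a \<Rightarrow> 'h) set" assume "V \<in> hcarrier (L2 M)"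
  then obtain v where v: "square_integrable M v" "V = ae_class M v" by (rule hcarrier_L2E)
  show "L2_map M T V \<in> hcarrier (L2 M)"
    using v square_integrable_bounded_linear[OF T v(1)] by (auto simp: L2_map_ae_class hcarrier_L2)
  show "L2_map M T (hscale (L2 M) a V) = hscale (L2 M) a (L2_map M T V)" for a
    by (simp add: v L2_map_ae_class hscale_L2 T.scaleR)
  fix W :: "('a \<Rightarrow> 'h) set" assume "W \<in> hcarrier (L2 M)"
  then obtain w where w: "square_integrable M w" "W = ae_class M w" by (rule hcarrier_L2E)
  show "L2_map M T (hadd (L2 M) V W) = hadd (L2 M) (L2_map M T V) (L2_map M T W)"
    by (simp add: v w L2_map_ae_class hadd_L2 T.add)
qed

end


section \<open>The operator of a square-integrable function is Hilbert-Schmidt\<close>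

context complete_measure
begin

lemma hnorm_type_hspace: "hnorm type_hspace x = norm x"
  by (simp add: hnorm_def type_hspace_def norm_eq_sqrt_inner)

lemma integral_inner_squared_le:
  fixes v :: "'a \<Rightarrow> 'h::real_inner"
  assumes v: "square_integrable M v"
  shows "(\<integral>\<omega>. (v \<omega> \<bullet> x)\<^sup>2 \<partial>M) \<le> (norm x)\<^sup>2 * (\<integral>\<omega>. (norm (v \<omega>))\<^sup>2 \<partial>M)"
proof -
  have "(\<integral>\<omega>. (v \<omega> \<bullet> x)\<^sup>2 \<partial>M) \<le> (\<integral>\<omega>. (norm x)\<^sup>2 * (norm (v \<omega>))\<^sup>2 \<partial>M)"
  proof (rule integral_mono)
    show "integrable M (\<lambda>\<omega>. (v \<omega> \<bullet> x)\<^sup>2)"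
      using square_integrable_inner_const[OF v, of x] by (simp add: square_integrable_def)
    show "integrable M (\<lambda>\<omega>. (norm x)\<^sup>2 * (norm (v \<omega>))\<^sup>2)" using v by (simp add: square_integrable_def)
    fix \<omega>
    have "\<bar>v \<omega> \<bullet> x\<bar>\<^sup>2 \<le> (norm (v \<omega>) * norm x)\<^sup>2"
      by (intro power_mono Cauchy_Schwarz_ineq2) simp
    then show "(v \<omega> \<bullet> x)\<^sup>2 \<le> (norm x)\<^sup>2 * (norm (v \<omega>))\<^sup>2" by (simp add: power_mult_distrib mult.commute)
  qed
  then show ?thesis by simp
qed

lemma hbounded_linear_H_op:
  fixes V :: "('a \<Rightarrow> 'h::{real_inner,banach}) set"
  assumes "V \<in> hcarrier (L2 M)"
  shows "hbounded_linear type_hspace (L2 M) (H_op M V)"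
  unfolding hbounded_linear_def hlinear_def
proof (intro conjI ballI allI exI[of _ "hnorm (L2 M) V"])
  obtain v where v: "square_integrable M v" "V = ae_class M v" using assms by (rule hcarrier_L2E)
  note sq = square_integrable_inner_const[OF v(1)]
  fix x y :: 'h and a :: real
  show "H_op M V x \<in> hcarrier (L2 M)" using sq by (auto simp: v H_op_ae_class hcarrier_L2)
  show "H_op M V (hadd type_hspace x y) = hadd (L2 M) (H_op M V x) (H_op M V y)"
    by (simp add: v H_op_ae_class hadd_L2 type_hspace_def inner_add_right)
  show "H_op M V (hscale type_hspace a x) = hscale (L2 M) a (H_op M V x)"
    by (simp add: v H_op_ae_class hscale_L2 type_hspace_def)
  have "sqrt (\<integral>\<omega>. (v \<omega> \<bullet> x)\<^sup>2 \<partial>M) \<le> sqrt ((norm x)\<^sup>2 * (\<integral>\<omega>. (norm (v \<omega>))\<^sup>2 \<partial>M))"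
    using integral_inner_squared_le[OF v(1), of x] by (rule real_sqrt_le_mono)
  then show "hnorm (L2 M) (H_op M V x) \<le> hnorm (L2 M) V * hnorm type_hspace x"
    using sq v by (simp add: H_op_ae_class hnorm_L2 real_sqrt_mult hnorm_type_hspace mult.commute)
qed

lemma has_sum_hip_H_op:
  assumes E: "orthonormal_basis E" and "U \<in> hcarrier (L2 M)" "V \<in> hcarrier (L2 M)"
  shows "((\<lambda>e. hip (L2 M) (H_op M U e) (H_op M V e)) has_sum hip (L2 M) U V) E"
proof -
  obtain u where u: "square_integrable M u" "U = ae_class M u" using assms(2) by (rule hcarrier_L2E)
  obtain v where v: "square_integrable M v" "V = ae_class M v" using assms(3) by (rule hcarrier_L2E)
  show ?thesis
    using has_sum_integral_inner[OF E u(1) v(1)] u v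
    by (simp add: H_op_ae_class hip_L2 square_integrable_inner_const)
qed

end

text \<open>
  An orthonormal basis exists, so a value that all of them share is unique and is the one that the
  definite description selects.
\<close>

lemma hip_HS_eqI:
  assumes "\<And>E :: 'h::{real_inner,banach} set. orthonormal_basis E \<Longrightarrow> ((\<lambda>e. hip G (A e) (B e)) has_sum r) E"
  shows "hip (HS G) A B = r"
proof -
  obtain E :: "'h set" where E: "orthonormal_basis E" using ex_orthonormal_basis by blast
  have "(THE r. \<forall>E::'h set. orthonormal_basis E \<longrightarrow> ((\<lambda>e. hip G (A e) (B e)) has_sum r) E) = r"
    using assms has_sum_unique[OF _ assms[OF E]] E by (intro the_equality) blast+
  then show ?thesis by (simp add: HS_def)
qed

context complete_measure
begin

lemma hip_HS_H_op:
  fixes U V :: "('a \<Rightarrow> 'h::{real_inner,banach}) set"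
  assumes "U \<in> hcarrier (L2 M)" "V \<in> hcarrier (L2 M)"
  shows "hip (HS (L2 M)) (H_op M U) (H_op M V) = hip (L2 M) U V"
  by (rule hip_HS_eqI) (rule has_sum_hip_H_op[OF _ assms])

lemma H_op_in_HS:
  fixes V :: "('a \<Rightarrow> 'h::{real_inner,banach}) set"
  assumes V: "V \<in> hcarrier (L2 M)"
  shows "H_op M V \<in> hcarrier (HS (L2 M))"
proof -
  have "(\<lambda>e. (hnorm (L2 M) (H_op M V e))\<^sup>2) summable_on E" if E: "orthonormal_basis E" for E :: "'h set"
  proof -
    have "(hnorm (L2 M) (H_op M V e))\<^sup>2 = hip (L2 M) (H_op M V e) (H_op M V e)" for e
    proof -
      have "H_op M V e \<in> hcarrier (L2 M)"
        using hbounded_linear_H_op[OF V] by (simp add: hbounded_linear_def hlinear_def type_hspace_def)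
      then show ?thesis
        by (simp add: hnorm_def hilbert_space.ip_nonneg[OF hilbert_space_L2])
    qed
    then show ?thesis using has_sum_hip_H_op[OF E V V] by (auto simp: summable_on_def)
  qed
  then show ?thesis using hbounded_linear_H_op[OF V] by (simp add: HS_def)
qed

text \<open>
  If \<open>\<langle>u, e\<rangle>\<close> and \<open>\<langle>v, e\<rangle>\<close> agree almost everywhere for each \<open>e\<close>, then every term of the Parseval
  series of \<open>u - v\<close> vanishes.  The exceptional null set may depend on \<open>e\<close>, and an uncountable basis
  excludes a pointwise argument.
\<close>

lemma H_op_inject:
  fixes U V :: "('a \<Rightarrow> 'h::{real_inner,banach}) set"
  assumes "U \<in> hcarrier (L2 M)" "V \<in> hcarrier (L2 M)" and eq: "H_op M U = H_op M V"
  shows "U = V"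
proof -
  obtain u where u: "square_integrable M u" "U = ae_class M u" using assms(1) by (rule hcarrier_L2E)
  obtain v where v: "square_integrable M v" "V = ae_class M v" using assms(2) by (rule hcarrier_L2E)
  note sq = square_integrable_diff[OF u(1) v(1)]
  obtain E :: "'h set" where E: "orthonormal_basis E" using ex_orthonormal_basis by blast
  have "(\<integral>\<omega>. ((u \<omega> - v \<omega>) \<bullet> e)\<^sup>2 \<partial>M) = 0" for e
  proof -
    have "H_op M U e = H_op M V e" using eq by simp
    then have "AE \<omega> in M. u \<omega> \<bullet> e = v \<omega> \<bullet> e" by (simp add: u v H_op_ae_class ae_class_eq_iff)
    then have "AE \<omega> in M. (u \<omega> - v \<omega>) \<bullet> e = 0"
      by eventually_elim (simp add: inner_diff_left)
    then show ?thesis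
      using integral_norm_squared_eq_0_iff[OF square_integrable_inner_const[OF sq, of e]] by simp
  qed
  then have "((\<lambda>e. 0) has_sum (\<integral>\<omega>. (norm (u \<omega> - v \<omega>))\<^sup>2 \<partial>M)) E"
    using has_sum_integral_norm_squared[OF E sq] by simp
  then have "(\<integral>\<omega>. (norm (u \<omega> - v \<omega>))\<^sup>2 \<partial>M) = 0"
    by (rule has_sum_unique) (rule has_sum_0, simp)
  then show ?thesis
    using integral_norm_squared_eq_0_iff[OF sq] by (simp add: u v ae_class_eq_iff)
qed

end


section \<open>Every Hilbert-Schmidt operator comes from a square-integrable function\<close>

context complete_measure
begin

lemma integral_norm_squared_orthonormal_sum:
  fixes a :: "'h::real_inner \<Rightarrow> 'a \<Rightarrow> real"
  assumes F: "finite F" "pairwise orthogonal F" "\<forall>e\<in>F. norm e = 1"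
    and a: "\<And>e. square_integrable M (a e)"
  shows "(\<integral>\<omega>. (norm (\<Sum>e\<in>F. a e \<omega> *\<^sub>R e))\<^sup>2 \<partial>M) = (\<Sum>e\<in>F. \<integral>\<omega>. (a e \<omega>)\<^sup>2 \<partial>M)"
proof -
  have "(norm (\<Sum>e\<in>F. a e \<omega> *\<^sub>R e))\<^sup>2 = (\<Sum>e\<in>F. (a e \<omega>)\<^sup>2)" for \<omega>
    using norm_diff_orthonormal_sum[OF F, of 0 "\<lambda>e. a e \<omega>"] by simp
  then show ?thesis using a by (simp add: square_integrable_def)
qed

text \<open>
  The functions \<open>a\<^sub>e\<close> are prescribed as the coefficients of the function sought.  By Pythagoras the
  squared distance between two finite partial sums is the sum of \<open>\<integral>a\<^sub>e\<^sup>2\<close> over the symmetric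
  difference of their index sets, so summability makes a suitable sequence of partial sums Cauchy.
\<close>

lemma square_integrable_orthonormal_series:
  fixes a :: "'h::{real_inner,banach} \<Rightarrow> 'a \<Rightarrow> real"
  assumes E: "pairwise orthogonal E" "\<forall>e\<in>E. norm e = 1"
    and a: "\<And>e. square_integrable M (a e)"
    and sum: "(\<lambda>e. \<integral>\<omega>. (a e \<omega>)\<^sup>2 \<partial>M) summable_on E"
  obtains u where "square_integrable M u" "\<And>e. e \<in> E \<Longrightarrow> AE \<omega> in M. u \<omega> \<bullet> e = a e \<omega>"
proof -
  define q where "q e = (\<integral>\<omega>. (a e \<omega>)\<^sup>2 \<partial>M)" for e
  have q_nonneg: "0 \<le> q e" for e by (simp add: q_def)
  have q: "q summable_on E" using sum by (simp add: q_def[abs_def])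
  have small_tail: "\<exists>F. finite F \<and> F \<subseteq> E \<and> (\<forall>G. finite G \<longrightarrow> G \<subseteq> E - F \<longrightarrow> sum q G \<le> \<epsilon>)"
    if \<epsilon>: "0 < \<epsilon>" for \<epsilon>
  proof -
    obtain F where F: "finite F" "F \<subseteq> E" "dist (sum q F) (infsum q E) \<le> \<epsilon>"
      using infsum_finite_approximation[OF q \<epsilon>] by blast
    have "sum q G \<le> \<epsilon>" if G: "finite G" "G \<subseteq> E - F" for G
    proof -
      have "sum q F + sum q G = sum q (F \<union> G)"
        using F(1) G by (subst sum.union_disjoint) auto
      also have "\<dots> \<le> infsum q E"
        using F G by (intro finite_sum_le_infsum[OF q]) (auto simp: q_nonneg)
      finally show ?thesis using F(3) by (simp add: dist_real_def)
    qed
    then show ?thesis using F by blast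
  qed
  have ex: "\<exists>F. finite F \<and> F \<subseteq> E \<and> (\<forall>G. finite G \<longrightarrow> G \<subseteq> E - F \<longrightarrow> sum q G \<le> inverse (real (Suc n)))"
    for n by (rule small_tail) simp
  have "\<exists>F. \<forall>n. finite (F n) \<and> F n \<subseteq> E \<and>
      (\<forall>G. finite G \<longrightarrow> G \<subseteq> E - F n \<longrightarrow> sum q G \<le> inverse (real (Suc n)))"
    by (intro choice allI ex)
  then obtain F where F_all: "\<forall>n. finite (F n) \<and> F n \<subseteq> E \<and>
      (\<forall>G. finite G \<longrightarrow> G \<subseteq> E - F n \<longrightarrow> sum q G \<le> inverse (real (Suc n)))" ..
  have F: "finite (F n)" "F n \<subseteq> E"
      "finite G \<Longrightarrow> G \<subseteq> E - F n \<Longrightarrow> sum q G \<le> inverse (real (Suc n))" for n G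
    using F_all by (blast, blast, blast)
  have E': "pairwise orthogonal G" "\<forall>e\<in>G. norm e = 1" if "G \<subseteq> E" for G
    using E that by (auto intro: pairwise_mono)
  define part where "part G \<omega> = (\<Sum>e\<in>G. a e \<omega> *\<^sub>R e)" for G \<omega>
  have sq: "square_integrable M (part G)" for G
    unfolding part_def
    by (intro square_integrable_sum square_integrable_bounded_linear[OF bounded_linear_scaleR_left] a)
  have part_norm: "(\<integral>\<omega>. (norm (part G \<omega>))\<^sup>2 \<partial>M) = sum q G" if "finite G" "G \<subseteq> E" for G
    unfolding part_def q_def using integral_norm_squared_orthonormal_sum[OF that(1) E'[OF that(2)] a] .
  have tail: "(\<integral>\<omega>. (norm (part (F m) \<omega> - part (F n) \<omega>))\<^sup>2 \<partial>M)
      \<le> 2 * inverse (real (Suc n)) + 2 * inverse (real (Suc m))" for m n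
  proof -
    \<comment> \<open>The common terms cancel, and each remaining index set avoids one of \<open>F m\<close> and \<open>F n\<close>.\<close>
    have "part (F m) \<omega> - part (F n) \<omega> = part (F m - F n) \<omega> + - part (F n - F m) \<omega>" for \<omega>
      unfolding part_def
      using sum.Int_Diff[OF F(1)[of m], of "\<lambda>e. a e \<omega> *\<^sub>R e" "F n"]
        sum.Int_Diff[OF F(1)[of n], of "\<lambda>e. a e \<omega> *\<^sub>R e" "F m"] by (simp add: Int_commute)
    then have "(\<integral>\<omega>. (norm (part (F m) \<omega> - part (F n) \<omega>))\<^sup>2 \<partial>M)
        = (\<integral>\<omega>. (norm (part (F m - F n) \<omega> + - part (F n - F m) \<omega>))\<^sup>2 \<partial>M)" by simp
    also have "\<dots> \<le> 2 * (\<integral>\<omega>. (norm (part (F m - F n) \<omega>))\<^sup>2 \<partial>M)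
        + 2 * (\<integral>\<omega>. (norm (- part (F n - F m) \<omega>))\<^sup>2 \<partial>M)"
      using square_integrable_scaleR[OF sq[of "F n - F m"], of "-1"]
      by (intro integral_norm_add_squared_le sq) simp
    also have "\<dots> = 2 * sum q (F m - F n) + 2 * sum q (F n - F m)"
      using F(1,2) by (simp add: part_norm subset_trans[OF Diff_subset])
    also have "\<dots> \<le> 2 * inverse (real (Suc n)) + 2 * inverse (real (Suc m))"
      using F(3)[of "F m - F n" n] F(3)[of "F n - F m" m] F(1,2) by fastforce
    finally show ?thesis .
  qed
  have inv0: "(\<lambda>n. inverse (real (Suc n))) \<longlonglongrightarrow> 0" by (rule LIMSEQ_inverse_real_of_nat)
  obtain u where u: "square_integrable M u"
    "(\<lambda>n. \<integral>\<omega>. (norm (part (F n) \<omega> - u \<omega>))\<^sup>2 \<partial>M) \<longlonglongrightarrow> 0"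
  proof (rule square_integrable_Cauchy_convergent)
    show "square_integrable M (part (F n))" for n by (rule sq)
    fix \<epsilon> :: real assume "0 < \<epsilon>"
    then have "eventually (\<lambda>n. inverse (real (Suc n)) < \<epsilon> / 4) sequentially"
      by (intro order_tendstoD(2)[OF inv0]) simp
    then obtain N where N: "\<And>n. N \<le> n \<Longrightarrow> inverse (real (Suc n)) < \<epsilon> / 4"
      unfolding eventually_sequentially by blast
    have "(\<integral>\<omega>. (norm (part (F m) \<omega> - part (F n) \<omega>))\<^sup>2 \<partial>M) < \<epsilon>" if "N \<le> m" "N \<le> n" for m n
      using tail[of m n] N[OF that(1)] N[OF that(2)] by linarith
    then show "\<exists>N. \<forall>m\<ge>N. \<forall>n\<ge>N. (\<integral>\<omega>. (norm (part (F m) \<omega> - part (F n) \<omega>))\<^sup>2 \<partial>M) < \<epsilon>" by blast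
  qed
  have "AE \<omega> in M. u \<omega> \<bullet> e = a e \<omega>" if e: "e \<in> E" for e
  proof -
    have norm_e: "norm e = 1" using E(2) e by blast
    have diff_sq: "square_integrable M (\<lambda>\<omega>. u \<omega> \<bullet> e - a e \<omega>)"
      by (intro square_integrable_diff square_integrable_inner_const u(1) a)
    have "(\<integral>\<omega>. (u \<omega> \<bullet> e - a e \<omega>)\<^sup>2 \<partial>M)
        \<le> 2 * (\<integral>\<omega>. (norm (part (F n) \<omega> - u \<omega>))\<^sup>2 \<partial>M) + 2 * inverse (real (Suc n))" for n
    proof -
      let ?x = "\<lambda>\<omega>. (u \<omega> - part (F n) \<omega>) \<bullet> e" and ?y = "\<lambda>\<omega>. part (F n) \<omega> \<bullet> e - a e \<omega>"
      have x: "square_integrable M ?x"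
        by (intro square_integrable_inner_const square_integrable_diff u(1) sq)
      have y: "square_integrable M ?y"
        by (intro square_integrable_inner_const square_integrable_diff a sq)
      have "(\<integral>\<omega>. (u \<omega> \<bullet> e - a e \<omega>)\<^sup>2 \<partial>M) = (\<integral>\<omega>. (norm (?x \<omega> + ?y \<omega>))\<^sup>2 \<partial>M)"
        by (simp add: inner_diff_left)
      also have "\<dots> \<le> 2 * (\<integral>\<omega>. (norm (?x \<omega>))\<^sup>2 \<partial>M) + 2 * (\<integral>\<omega>. (norm (?y \<omega>))\<^sup>2 \<partial>M)"
        by (rule integral_norm_add_squared_le[OF x y])
      finally have "(\<integral>\<omega>. (u \<omega> \<bullet> e - a e \<omega>)\<^sup>2 \<partial>M)
          \<le> 2 * (\<integral>\<omega>. (?x \<omega>)\<^sup>2 \<partial>M) + 2 * (\<integral>\<omega>. (?y \<omega>)\<^sup>2 \<partial>M)" by simp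
      moreover have "(\<integral>\<omega>. (?x \<omega>)\<^sup>2 \<partial>M) \<le> (\<integral>\<omega>. (norm (part (F n) \<omega> - u \<omega>))\<^sup>2 \<partial>M)"
        using integral_inner_squared_le[OF square_integrable_diff[OF u(1) sq[of "F n"]], of e]
        by (simp add: norm_e norm_minus_commute)
      moreover have "(\<integral>\<omega>. (?y \<omega>)\<^sup>2 \<partial>M) \<le> inverse (real (Suc n))"
      proof -
        have "part (F n) \<omega> \<bullet> e = (if e \<in> F n then a e \<omega> else 0)" for \<omega>
        proof -
          have "part (F n) \<omega> \<bullet> e = (\<Sum>b\<in>F n. if b = e then a e \<omega> else 0)"
            unfolding part_def inner_sum_left
          proof (rule sum.cong)
            fix b assume b: "b \<in> F n"
            have "b \<bullet> e = (if b = e then 1 else 0)"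
            proof (cases "b = e")
              case True
              then show ?thesis using norm_e by (simp add: norm_eq_1)
            next
              case False
              then show ?thesis using E(1) e b F(2)[of n] by (auto simp: pairwise_def orthogonal_def)
            qed
            then show "(a b \<omega> *\<^sub>R b) \<bullet> e = (if b = e then a e \<omega> else 0)" by simp
          qed simp
          then show ?thesis using F(1) by simp
        qed
        \<comment> \<open>If \<open>e\<close> is not in \<open>F n\<close>, then \<open>{e}\<close> is itself a small tail.\<close>
        then have "(\<integral>\<omega>. (?y \<omega>)\<^sup>2 \<partial>M) = (if e \<in> F n then 0 else q e)"
          by (simp add: q_def)
        then show ?thesis using F(3)[of "{e}" n] e by auto
      qed
      ultimately show ?thesis by linarith
    qed
    moreover have "(\<lambda>n. 2 * (\<integral>\<omega>. (norm (part (F n) \<omega> - u \<omega>))\<^sup>2 \<partial>M) + 2 * inverse (real (Suc n)))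
        \<longlonglongrightarrow> 2 * 0 + 2 * 0"
      by (intro tendsto_intros u(2) inv0)
    ultimately have "(\<integral>\<omega>. (u \<omega> \<bullet> e - a e \<omega>)\<^sup>2 \<partial>M) \<le> 2 * 0 + 2 * 0"
      by (intro LIMSEQ_le_const) auto
    moreover have "0 \<le> (\<integral>\<omega>. (u \<omega> \<bullet> e - a e \<omega>)\<^sup>2 \<partial>M)" by simp
    ultimately have "(\<integral>\<omega>. (norm (u \<omega> \<bullet> e - a e \<omega>))\<^sup>2 \<partial>M) = 0" by simp
    then show ?thesis using integral_norm_squared_eq_0_iff[OF diff_sq] by simp
  qed
  with u(1) show thesis by (rule that)
qed

text \<open>
  The function built from the values of \<open>A\<close> on a basis has the right operator on the basis, hence on
  its span by linearity.  The squared norm of the difference of the two operators at \<open>x\<close> is then at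
  most \<open>K \<parallel>x - y\<parallel>\<^sup>2\<close> for every \<open>y\<close> in the span, and the span is dense.
\<close>

lemma H_op_surj:
  fixes A :: "'h::{real_inner,banach} \<Rightarrow> ('a \<Rightarrow> real) set"
  assumes A: "A \<in> hcarrier (HS (L2 M))"
  obtains U where "U \<in> hcarrier (L2 M)" "H_op M U = A"
proof -
  have lin: "hlinear type_hspace (L2 M) A"
    and "\<exists>B. \<forall>x. hnorm (L2 M) (A x) \<le> B * norm x"
    and sum: "\<And>E :: 'h set. orthonormal_basis E \<Longrightarrow> (\<lambda>e. (hnorm (L2 M) (A e))\<^sup>2) summable_on E"
    using A by (auto simp: HS_def hbounded_linear_def hnorm_type_hspace) (auto simp: type_hspace_def)
  then obtain B where B: "\<And>x. hnorm (L2 M) (A x) \<le> B * norm x" by blast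
  have "\<exists>f. square_integrable M f \<and> A x = ae_class M f" for x
  proof -
    have "A x \<in> hcarrier (L2 M)" using lin by (simp add: hlinear_def type_hspace_def)
    then show ?thesis by (auto elim: hcarrier_L2E)
  qed
  then obtain a where a: "\<And>x. square_integrable M (a x)" "\<And>x. A x = ae_class M (a x)" by metis
  have a_add: "AE \<omega> in M. a (x + y) \<omega> = a x \<omega> + a y \<omega>" for x y
    using lin by (simp add: hlinear_def type_hspace_def a(2) hadd_L2 ae_class_eq_iff)
  have a_scale: "AE \<omega> in M. a (c *\<^sub>R x) \<omega> = c * a x \<omega>" for c x
    using lin by (simp add: hlinear_def type_hspace_def a(2) hscale_L2 ae_class_eq_iff)
  have a_bound: "(\<integral>\<omega>. (a x \<omega>)\<^sup>2 \<partial>M) \<le> B\<^sup>2 * (norm x)\<^sup>2" for x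
  proof -
    have "sqrt (\<integral>\<omega>. (a x \<omega>)\<^sup>2 \<partial>M) \<le> B * norm x" using B[of x] by (simp add: a hnorm_L2)
    then have "(sqrt (\<integral>\<omega>. (a x \<omega>)\<^sup>2 \<partial>M))\<^sup>2 \<le> (B * norm x)\<^sup>2" by (rule power_mono) simp
    then show ?thesis by (simp add: power_mult_distrib)
  qed
  obtain E :: "'h set" where E: "orthonormal_basis E" using ex_orthonormal_basis by blast
  have "(\<lambda>e. \<integral>\<omega>. (a e \<omega>)\<^sup>2 \<partial>M) summable_on E"
    using sum[OF E] by (simp add: a hnorm_L2)
  then obtain u where u: "square_integrable M u" "\<And>e. e \<in> E \<Longrightarrow> AE \<omega> in M. u \<omega> \<bullet> e = a e \<omega>"
    using square_integrable_orthonormal_series[of E a] E a(1) unfolding orthonormal_basis_def by metis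
  define K where "K = 2 * (\<integral>\<omega>. (norm (u \<omega>))\<^sup>2 \<partial>M) + 2 * B\<^sup>2"
  let ?S = "{x. AE \<omega> in M. u \<omega> \<bullet> x = a x \<omega>}"
  have "subspace ?S"
  proof (rule subspaceI)
    show "0 \<in> ?S" using a_scale[of 0 0] by simp
  next
    fix x y assume "x \<in> ?S" "y \<in> ?S"
    then have "AE \<omega> in M. u \<omega> \<bullet> x = a x \<omega>" "AE \<omega> in M. u \<omega> \<bullet> y = a y \<omega>" by simp_all
    then have "AE \<omega> in M. u \<omega> \<bullet> (x + y) = a (x + y) \<omega>"
      using a_add[of x y] by eventually_elim (simp add: inner_add_right)
    then show "x + y \<in> ?S" by simp
  next
    fix c x assume "x \<in> ?S"
    then have "AE \<omega> in M. u \<omega> \<bullet> x = a x \<omega>" by simp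
    then have "AE \<omega> in M. u \<omega> \<bullet> (c *\<^sub>R x) = a (c *\<^sub>R x) \<omega>"
      using a_scale[of c x] by eventually_elim simp
    then show "c *\<^sub>R x \<in> ?S" by simp
  qed
  then have spanE: "span E \<subseteq> ?S" using u(2) by (intro span_minimal) auto
  have "AE \<omega> in M. u \<omega> \<bullet> x = a x \<omega>" for x
  proof -
    define \<delta> where "\<delta> = (\<integral>\<omega>. (u \<omega> \<bullet> x - a x \<omega>)\<^sup>2 \<partial>M)"
    have sq: "square_integrable M (\<lambda>\<omega>. u \<omega> \<bullet> x - a x \<omega>)" for x
      by (intro square_integrable_diff square_integrable_inner_const u(1) a)
    have \<delta>_le: "\<delta> \<le> K * (norm (x - y))\<^sup>2" if y: "y \<in> span E" for y
    proof -
      let ?f = "\<lambda>\<omega>. u \<omega> \<bullet> (x - y)" and ?g = "\<lambda>\<omega>. (- 1) *\<^sub>R a (x - y) \<omega>"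
      have f: "square_integrable M ?f" by (intro square_integrable_inner_const u(1))
      have g: "square_integrable M ?g" by (intro square_integrable_scaleR a(1))
      have "AE \<omega> in M. u \<omega> \<bullet> y = a y \<omega>" using spanE y by blast
      then have ae: "AE \<omega> in M. (u \<omega> \<bullet> x - a x \<omega>)\<^sup>2 = (norm (?f \<omega> + ?g \<omega>))\<^sup>2"
        using a_add[of "x - y" y] by eventually_elim (simp add: inner_diff_right algebra_simps)
      have "\<delta> = (\<integral>\<omega>. (norm (?f \<omega> + ?g \<omega>))\<^sup>2 \<partial>M)"
        unfolding \<delta>_def
        using borel_measurable_norm_squared[OF sq[of x]]
          borel_measurable_norm_squared[OF square_integrable_add[OF f g]]
        by (intro integral_cong_AE ae) simp_all
      also have "\<dots> \<le> 2 * (\<integral>\<omega>. (norm (?f \<omega>))\<^sup>2 \<partial>M) + 2 * (\<integral>\<omega>. (norm (?g \<omega>))\<^sup>2 \<partial>M)"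
        by (rule integral_norm_add_squared_le[OF f g])
      also have "\<dots> = 2 * (\<integral>\<omega>. (u \<omega> \<bullet> (x - y))\<^sup>2 \<partial>M) + 2 * (\<integral>\<omega>. (a (x - y) \<omega>)\<^sup>2 \<partial>M)"
        by simp
      also have "\<dots> \<le> 2 * ((norm (x - y))\<^sup>2 * (\<integral>\<omega>. (norm (u \<omega>))\<^sup>2 \<partial>M)) + 2 * (B\<^sup>2 * (norm (x - y))\<^sup>2)"
        using integral_inner_squared_le[OF u(1), of "x - y"] a_bound[of "x - y"] by linarith
      also have "\<dots> = K * (norm (x - y))\<^sup>2" by (simp add: K_def algebra_simps)
      finally show ?thesis .
    qed
    have "x \<in> closure (span E)" using E by (simp add: orthonormal_basis_def)
    then obtain y where y: "\<And>n. y n \<in> span E" "y \<longlonglongrightarrow> x" by (meson closure_sequential)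
    have "(\<lambda>n. K * (norm (x - y n))\<^sup>2) \<longlonglongrightarrow> K * (norm (x - x))\<^sup>2"
      by (intro tendsto_intros y(2))
    then have "\<delta> \<le> K * (norm (x - x))\<^sup>2"
      by (rule LIMSEQ_le_const) (use \<delta>_le y(1) in auto)
    moreover have "0 \<le> \<delta>" by (simp add: \<delta>_def)
    ultimately have "\<delta> = 0" by simp
    then show ?thesis using integral_norm_squared_eq_0_iff[OF sq[of x]] by (simp add: \<delta>_def)
  qed
  then have "H_op M (ae_class M u) x = A x" for x
    by (simp add: H_op_ae_class a(2) ae_class_eq_iff)
  then have "H_op M (ae_class M u) = A" by (rule ext)
  moreover have "ae_class M u \<in> hcarrier (L2 M)" using u(1) by (simp add: hcarrier_L2)
  ultimately show thesis by (rule that[rotated])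
qed

end


section \<open>The natural isomorphism\<close>

text \<open>
  Every axiom for \<open>W\<close> is the image of the axiom for \<open>V\<close>, because each element of the carrier of \<open>W\<close> is
  a value of \<open>f\<close>.  The zero needs its own hypothesis, being a component of the record rather
  than determined by the other operations.
\<close>

lemma hilbert_space_transport:
  assumes V: "hilbert_space V" and f: "hlinear V W f" and bij: "bij_betw f (hcarrier V) (hcarrier W)"
    and ip: "\<And>x y. x \<in> hcarrier V \<Longrightarrow> y \<in> hcarrier V \<Longrightarrow> hip W (f x) (f y) = hip V x y"
    and zero: "hzero W = f (hzero V)"
  shows "hilbert_space W"
proof -
  interpret V: hilbert_space V by (rule V)
  have car: "\<exists>x\<in>hcarrier V. w = f x" if "w \<in> hcarrier W" for w
    using bij that by (auto simp: bij_betw_def)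
  have closed: "x \<in> hcarrier V \<Longrightarrow> f x \<in> hcarrier W" for x
    using f by (simp add: hlinear_def)
  have add: "x \<in> hcarrier V \<Longrightarrow> y \<in> hcarrier V \<Longrightarrow> hadd W (f x) (f y) = f (hadd V x y)" for x y
    using f by (simp add: hlinear_def)
  have scale: "x \<in> hcarrier V \<Longrightarrow> hscale W a (f x) = f (hscale V a x)" for a x
    using f by (simp add: hlinear_def)
  note ops = closed add scale zero ip V.add_closed V.scale_closed V.zero_closed
  have dist: "hdist W (f x) (f y) = hdist V x y" if "x \<in> hcarrier V" "y \<in> hcarrier V" for x y
    using that by (simp add: hdist_def hnorm_def ops)
  show ?thesis
  proof
    show "hzero W \<in> hcarrier W" by (simp add: ops)
    fix u v w and a b :: real
    assume "u \<in> hcarrier W"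
    then obtain x where x: "x \<in> hcarrier V" "u = f x" using car by blast
    show "hscale W a u \<in> hcarrier W" "hadd W u (hzero W) = u" "hadd W u (hscale W (- 1) u) = hzero W"
      "hscale W (a + b) u = hadd W (hscale W a u) (hscale W b u)"
      "hscale W a (hscale W b u) = hscale W (a * b) u" "hscale W 1 u = u" "0 \<le> hip W u u"
      using x(1) by (simp_all add: x(2) ops V.add_zero V.add_neg V.scale_add_left V.scale_scale
          V.scale_one V.ip_nonneg)
    show "u = hzero W" if "hip W u u = 0"
      using that x V.ip_definite by (auto simp: ops)
    assume "v \<in> hcarrier W"
    then obtain y where y: "y \<in> hcarrier V" "v = f y" using car by blast
    show "hadd W u v \<in> hcarrier W" "hadd W u v = hadd W v u"
      "hscale W a (hadd W u v) = hadd W (hscale W a u) (hscale W a v)"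
      "hip W u v = hip W v u" "hip W (hscale W a u) v = a * hip W u v"
      using x(1) y(1) by (simp_all add: x(2) y(2) ops V.scale_add_right V.ip_scale_left)
        (metis V.add_commute V.ip_commute)+
    assume "w \<in> hcarrier W"
    then obtain z where z: "z \<in> hcarrier V" "w = f z" using car by blast
    show "hadd W (hadd W u v) w = hadd W u (hadd W v w)"
      "hip W (hadd W u v) w = hip W u w + hip W v w"
      using x(1) y(1) z(1) by (simp_all add: x(2) y(2) z(2) ops V.add_assoc V.ip_add_left)
  next
    fix s :: "nat \<Rightarrow> _"
    assume s: "range s \<subseteq> hcarrier W"
      and Cauchy: "\<And>\<epsilon>. 0 < \<epsilon> \<Longrightarrow> \<exists>N. \<forall>m\<ge>N. \<forall>n\<ge>N. hdist W (s m) (s n) < \<epsilon>"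
    have "\<exists>x. x \<in> hcarrier V \<and> s n = f x" for n using s car by blast
    then obtain t where t: "\<And>n. t n \<in> hcarrier V" "\<And>n. s n = f (t n)" by metis
    have "\<exists>x\<in>hcarrier V. (\<lambda>n. hdist V (t n) x) \<longlonglongrightarrow> 0"
    proof (rule V.complete)
      show "range t \<subseteq> hcarrier V" using t(1) by blast
      show "\<exists>N. \<forall>m\<ge>N. \<forall>n\<ge>N. hdist V (t m) (t n) < \<epsilon>" if "0 < \<epsilon>" for \<epsilon>
        using Cauchy[OF that] by (simp add: t dist)
    qed
    then obtain x where x: "x \<in> hcarrier V" "(\<lambda>n. hdist V (t n) x) \<longlonglongrightarrow> 0" by blast
    then have "(\<lambda>n. hdist W (s n) (f x)) \<longlonglongrightarrow> 0" by (simp add: t dist)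
    with x(1) closed show "\<exists>w\<in>hcarrier W. (\<lambda>n. hdist W (s n) w) \<longlonglongrightarrow> 0" by blast
  qed
qed

context complete_measure
begin

theorem hilbert_isomorphism_H_op:
  "hilbert_isomorphism (L2 M :: ('a \<Rightarrow> 'h::{real_inner,banach}) set hspace) (HS (L2 M)) (H_op M)"
proof -
  let ?V = "L2 M :: ('a \<Rightarrow> 'h) set hspace"
  have lin: "hlinear ?V (HS (L2 M)) (H_op M)"
    unfolding hlinear_def
  proof (intro conjI ballI allI)
    fix U :: "('a \<Rightarrow> 'h) set" and a :: real assume U: "U \<in> hcarrier ?V"
    show "H_op M U \<in> hcarrier (HS (L2 M))" by (rule H_op_in_HS[OF U])
    obtain u where u: "U = ae_class M u" using U by (rule hcarrier_L2E)
    show "H_op M (hscale ?V a U) = hscale (HS (L2 M)) a (H_op M U)"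
      by (simp add: u HS_def H_op_ae_class hscale_L2 fun_eq_iff)
    fix V :: "('a \<Rightarrow> 'h) set" assume "V \<in> hcarrier ?V"
    then obtain v where v: "V = ae_class M v" by (rule hcarrier_L2E)
    show "H_op M (hadd ?V U V) = hadd (HS (L2 M)) (H_op M U) (H_op M V)"
      by (simp add: u v HS_def H_op_ae_class hadd_L2 fun_eq_iff inner_add_left)
  qed
  have bij: "bij_betw (H_op M) (hcarrier ?V) (hcarrier (HS (L2 M)))"
  proof (rule bij_betw_imageI)
    show "inj_on (H_op M) (hcarrier ?V)" by (intro inj_onI H_op_inject)
    show "H_op M ` hcarrier ?V = hcarrier (HS (L2 M))"
    proof (intro equalityI subsetI)
      fix A assume "A \<in> H_op M ` hcarrier ?V"
      then show "A \<in> hcarrier (HS (L2 M))" using H_op_in_HS by blast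
    next
      fix A :: "'h \<Rightarrow> ('a \<Rightarrow> real) set" assume "A \<in> hcarrier (HS (L2 M))"
      then obtain U where "U \<in> hcarrier ?V" "H_op M U = A" by (rule H_op_surj)
      then show "A \<in> H_op M ` hcarrier ?V" by blast
    qed
  qed
  have zero: "hzero (HS (L2 M)) = H_op M (hzero ?V)"
    by (simp add: HS_def hzero_L2 H_op_ae_class fun_eq_iff)
  have "hilbert_space (HS (L2 M) :: ('h \<Rightarrow> ('a \<Rightarrow> real) set) hspace)"
    by (rule hilbert_space_transport[OF hilbert_space_L2 lin bij hip_HS_H_op zero])
  then show ?thesis
    unfolding hilbert_isomorphism_def using hilbert_space_L2 lin bij hip_HS_H_op by blast
qed

lemma H_op_natural:
  fixes T :: "'h::{real_inner,banach} \<Rightarrow> 'k::{real_inner,banach}"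
  assumes T: "bounded_linear T" and V: "V \<in> hcarrier (L2 M)"
  shows "H_op M (L2_map M T V) = HS_map T (H_op M V)"
proof -
  obtain v where v: "V = ae_class M v" using V by (rule hcarrier_L2E)
  show ?thesis
    by (simp add: v L2_map_ae_class H_op_ae_class HS_map_def fun_eq_iff adjoint_bounded_linear[OF T])
qed

text \<open>
  Writing an operator as \<open>H\<^sub>v\<close>, its composition with \<open>T\<^sup>*\<close> is \<open>H\<^sub>T\<^sub>v\<close>, and the isometry turns the bound
  for \<open>v \<mapsto> T v\<close> into the required one.  This also shows that the composition is Hilbert-Schmidt.
\<close>

lemma hbounded_linear_HS_map:
  fixes T :: "'h::{real_inner,banach} \<Rightarrow> 'k::{real_inner,banach}"
  assumes T: "bounded_linear T"
  shows "hbounded_linear (HS (L2 M)) (HS (L2 M)) (HS_map T :: ('h \<Rightarrow> ('a \<Rightarrow> real) set) \<Rightarrow> _)"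
proof -
  note L2_map = hbounded_linear_L2_map[OF T]
  have L2_map_closed: "L2_map M T V \<in> hcarrier (L2 M)" if "V \<in> hcarrier (L2 M)" for V
    using L2_map that by (simp add: hbounded_linear_def hlinear_def)
  obtain B where B: "\<And>V. V \<in> hcarrier (L2 M) \<Longrightarrow> hnorm (L2 M) (L2_map M T V) \<le> B * hnorm (L2 M) V"
    using L2_map by (auto simp: hbounded_linear_def)
  have main: "HS_map T A \<in> hcarrier (HS (L2 M)) \<and>
      hnorm (HS (L2 M)) (HS_map T A) \<le> B * hnorm (HS (L2 M)) A"
    if A: "A \<in> hcarrier (HS (L2 M))" for A :: "'h \<Rightarrow> ('a \<Rightarrow> real) set"
  proof -
    obtain V where V: "V \<in> hcarrier (L2 M)" "H_op M V = A" using A by (rule H_op_surj)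
    have "HS_map T A = H_op M (L2_map M T V)" using H_op_natural[OF T V(1)] V(2) by simp
    then show ?thesis
      using H_op_in_HS[OF L2_map_closed[OF V(1)]] B[OF V(1)] hip_HS_H_op[OF V(1) V(1)]
        hip_HS_H_op[OF L2_map_closed L2_map_closed, OF V(1) V(1)] V(2)
      by (simp add: hnorm_def)
  qed
  show ?thesis
    unfolding hbounded_linear_def hlinear_def
  proof (intro conjI ballI allI exI[of _ B])
    show "HS_map T (hadd (HS (L2 M)) A C) = hadd (HS (L2 M)) (HS_map T A) (HS_map T C)"
      "HS_map T (hscale (HS (L2 M)) c A) = hscale (HS (L2 M)) c (HS_map T A)"
      for A C :: "'h \<Rightarrow> ('a \<Rightarrow> real) set" and c
      by (simp_all add: HS_map_def HS_def fun_eq_iff)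
  qed (use main in auto)
qed

end

theorem proposition2p3:
  fixes M :: "'a measure"
  assumes "complete_measure M"
  shows "hilbert_isomorphism
           (L2 M :: ('a \<Rightarrow> 'h::{real_inner,banach}) set hspace) (HS (L2_real M)) (H_op M) \<and>
         (\<forall>T :: 'h \<Rightarrow> 'k::{real_inner,banach}. bounded_linear T \<longrightarrow>
           hbounded_linear (L2 M) (L2 M) (L2_map M T) \<and>
           hbounded_linear (HS (L2_real M)) (HS (L2_real M))
             (HS_map T :: ('h \<Rightarrow> ('a \<Rightarrow> real) set) \<Rightarrow> _) \<and>
           (\<forall>V \<in> hcarrier (L2 M). H_op M (L2_map M T V) = HS_map T (H_op M V)))"
proof -
  interpret complete_measure M by (rule assms)
  show ?thesis
    unfolding L2_real_eq_L2
    using hilbert_isomorphism_H_op hbounded_linear_L2_map hbounded_linear_HS_map H_op_natural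
    by (intro conjI allI impI ballI)
qed

end
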